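(* For any $r,t \in \mathbb{N}$, there exists $C=C(r,t) \in \mathbb{N}$ such that for every $n \in \mathbb{N}$: if $\mathcal{F} \subset S_n$ is $(t-1)$-intersection-free, then there exists a $t$-intersecting $C$-junta $\mathcal{J} \subset S_n$ such that $|\mathcal{F} \setminus \mathcal{J}| \leq C\, n!/n^r$.
   Context: $S_n$ denotes the symmetric group on $[n]=\{1,2,\ldots,n\}$. A family $\mathcal{F} \subset S_n$ is $(t-1)$-intersection-free if for any two distinct $\sigma,\tau \in \mathcal{F}$ we have $|\{i \in [n] : \sigma(i)=\tau(i)\}| \neq t-1$. A family $\mathcal{J} \subset S_n$ is $t$-intersecting if for any $\sigma,\tau \in \mathcal{J}$ we have $|\{i \in [n] : \sigma(i)=\tau(i)\}| \geq t$. For bijections $\pi_i : S_i \to T_i$ with $S_i,T_i \subset [n]$ ($i=1,\ldots,l$), define $$\langle \pi_1,\ldots,\pi_l \rangle := \{\sigma \in S_n :\ \exists i \in [l]\ \forall j \in S_i,\ \sigma(j)=\pi_i(j)\}.$$ A family $\mathcal{J} \subset S_n$ is a $C$-junta if $\mathcal{J} = \langle \pi_1,\ldots,\pi_l\rangle$ for some bijections $\pi_i :S_i \to T_i$ between subsets of $[n]$, where $l \leq C$ and $|S_i| \leq C$ for all $i \in [l]$ (the case $l=0$, giving the empty family, is allowed). *)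

theory Defs
  imports Complex_Main "HOL-Combinatorics.Permutations"
begin

definition Sym :: "nat \<Rightarrow> (nat \<Rightarrow> nat) set" where
  "Sym n = {\<sigma>. \<sigma> permutes {1..n}}"

definition agreement :: "nat \<Rightarrow> (nat \<Rightarrow> nat) \<Rightarrow> (nat \<Rightarrow> nat) \<Rightarrow> nat set" where
  "agreement n \<sigma> \<tau> = {i \<in> {1..n}. \<sigma> i = \<tau> i}"

text \<open>The forbidden size is an integer, so that \<open>t - 1\<close> is not truncated at \<open>t = 0\<close>.\<close>

definition intersection_free :: "nat \<Rightarrow> int \<Rightarrow> (nat \<Rightarrow> nat) set \<Rightarrow> bool" where
  "intersection_free n s F \<longleftrightarrow>
     (\<forall>\<sigma>\<in>F. \<forall>\<tau>\<in>F. \<sigma> \<noteq> \<tau> \<longrightarrow> int (card (agreement n \<sigma> \<tau>)) \<noteq> s)"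

text \<open>The two permutations need not be distinct: a nonempty \<open>t\<close>-intersecting family
  has \<open>n \<ge> t\<close>.\<close>

definition t_intersecting :: "nat \<Rightarrow> nat \<Rightarrow> (nat \<Rightarrow> nat) set \<Rightarrow> bool" where
  "t_intersecting n t J \<longleftrightarrow> (\<forall>\<sigma>\<in>J. \<forall>\<tau>\<in>J. card (agreement n \<sigma> \<tau>) \<ge> t)"

text \<open>The family \<open>\<langle>\<pi> 1, \<dots>, \<pi> l\<rangle>\<close>, where \<open>\<pi> i\<close> is regarded as a map with domain \<open>S i\<close>;
  its values outside \<open>S i\<close> are irrelevant.\<close>

definition generated :: "nat \<Rightarrow> nat \<Rightarrow> (nat \<Rightarrow> nat set) \<Rightarrow> (nat \<Rightarrow> nat \<Rightarrow> nat) \<Rightarrow> (nat \<Rightarrow> nat) set" where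
  "generated n l S \<pi> = {\<sigma> \<in> Sym n. \<exists>i\<in>{1..l}. \<forall>j\<in>S i. \<sigma> j = \<pi> i j}"

definition junta :: "nat \<Rightarrow> nat \<Rightarrow> (nat \<Rightarrow> nat) set \<Rightarrow> bool" where
  "junta n C J \<longleftrightarrow>
     (\<exists>l S T \<pi>. l \<le> C \<and>
        (\<forall>i\<in>{1..l}. S i \<subseteq> {1..n} \<and> T i \<subseteq> {1..n} \<and> bij_betw (\<pi> i) (S i) (T i) \<and> card (S i) \<le> C) \<and>
        J = generated n l S \<pi>)"

end

theory Submission
  imports Defs "HOL-Real_Asymp.Real_Asymp"
begin

text \<open>
  A permutation is identified with its graph, a set of \<open>n\<close> cells of the \<open>n \<times> n\<close> board; the
  agreements of \<open>\<sigma>\<close> and \<open>\<tau>\<close> are then the common cells, and the generators of a junta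
  are partial matchings \<open>S\<close>, each standing for the star of all permutations containing \<open>S\<close>.
  The case \<open>t = 0\<close> and bounded \<open>n\<close> are trivial, so let \<open>t \<ge> 1\<close> and \<open>n\<close> be large.

  \<^emph>\<open>Decomposition.\<close> Fix a small \<open>\<epsilon> > 0\<close> and put \<open>R = n\<close> to the power \<open>1 - \<epsilon>\<close>. While \<open>F\<close>
  has more than \<open>n! / n^r\<close> members, choose among the partial matchings up to a fixed large size one,
  \<open>S\<close>, that maximises \<open>R^|S|\<close> times the number of members of \<open>F\<close> containing \<open>S\<close>, and remove these
  members. Maximality makes the removed piece spread out over the star of \<open>S\<close>: prescribing a
  bounded number \<open>k\<close> of further cells reduces it by a factor of at least \<open>R^k\<close>. Since \<open>F\<close> is not
  tiny, \<open>S\<close> stays well below the size limit and the piece has density at least \<open>n^(-K)\<close> in its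
  star. Such a piece is called quasirandom here, and
  \<open>quasirandom_decomposition\<close> collects the outcome.

  \<^emph>\<open>Two pieces meet in every possible way.\<close> Let \<open>G\<close> and \<open>G'\<close> be quasirandom pieces over
  \<open>S\<close> and \<open>S'\<close>. For a set \<open>X\<close> of \<open>k\<close> cells let \<open>p(X)\<close> be the proportion of members of \<open>G\<close>
  that contain \<open>X\<close> outside \<open>S\<close>, and define \<open>q(X)\<close> from \<open>G'\<close> in the same way. The function sending
  \<open>\<sigma>\<close> to the sum of \<open>p(X)\<close> over the \<open>X\<close> inside \<open>\<sigma>\<close> has average at most \<open>1/k!\<close> on the star
  and changes very little under a transposition, because \<open>p\<close> is uniformly small; so it is
  concentrated so strongly that even its average over a subfamily of density \<open>n^(-K)\<close> is at most
  \<open>1/k! + o(1)\<close>. That average is the sum of the squares \<open>p(X)^2\<close>, which forces \<open>p\<close> to be close in mean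
  square to a constant (\<open>quasirandom_sum_link_sq\<close>). The same holds for \<open>q\<close>, and so the sum of
  \<open>p(X) q(X)\<close> is \<open>1/k! + o(1)\<close> (\<open>quasirandom_correlation\<close>). In other words, up to bounded order
  the number of common cells of random members of \<open>G\<close> and \<open>G'\<close> has the factorial moments of a
  Poisson variable of mean 1. A Bonferroni inequality that uses only the orders \<open>m\<close> to
  \<open>m + 3\<close> then shows that exactly \<open>m\<close> extra common cells occur with probability at least about
  \<open>(1/m!) (1 - 1 + 1/2 - 1/6) > 0\<close>. If \<open>S\<close> and \<open>S'\<close> had fewer than \<open>t\<close> cells in common,
  this would give a pair with exactly \<open>t - 1\<close> agreements (\<open>quasirandom_exact_agreement\<close>).
  In a \<open>(t - 1)\<close>-intersection-free family the matchings \<open>S\<close> are therefore pairwise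
  \<open>t\<close>-intersecting.

  \<^emph>\<open>Bounding the number of generators.\<close> The matchings \<open>S\<close> have size at most \<open>q\<close>, but there may
  be many of them. Enlarge them to a maximal \<open>t\<close>-intersecting family of sets of size at most
  \<open>q\<close>; a branching argument shows that such a family has at most \<open>q^q\<close> inclusion-minimal
  members (\<open>t_intersecting_bounded_cover\<close>). Those contained in some \<open>S\<close> are partial matchings,
  and they generate the junta.
\<close>

section \<open>Stars of partial matchings\<close>

definition pts :: "nat \<Rightarrow> (nat \<Rightarrow> nat) \<Rightarrow> (nat \<times> nat) set" where
  "pts n \<sigma> = (\<lambda>i. (i, \<sigma> i)) ` {1..n}"

definition star :: "nat \<Rightarrow> (nat \<times> nat) set \<Rightarrow> (nat \<Rightarrow> nat) set" where
  "star n S = {\<sigma> \<in> Sym n. S \<subseteq> pts n \<sigma>}"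

lemma mem_pts [simp]: "(i, j) \<in> pts n \<sigma> \<longleftrightarrow> i \<in> {1..n} \<and> j = \<sigma> i"
  by (auto simp: pts_def)

lemma finite_pts [simp]: "finite (pts n \<sigma>)"
  by (simp add: pts_def)

lemma card_pts [simp]: "card (pts n \<sigma>) = n"
  by (simp add: pts_def card_image inj_on_def)

lemma finite_Sym [simp]: "finite (Sym n)"
  by (simp add: Sym_def finite_permutations)

lemma card_Sym: "card (Sym n) = fact n"
  unfolding Sym_def using card_permutations[of "{1..n}" n] by simp

lemma star_subset_Sym: "star n S \<subseteq> Sym n"
  by (auto simp: star_def)

lemma finite_star [simp]: "finite (star n S)"
  using finite_subset[OF star_subset_Sym] by simp

lemma star_empty [simp]: "star n {} = Sym n"
  by (auto simp: star_def)

lemma card_agreement: "card (agreement n \<sigma> \<tau>) = card (pts n \<sigma> \<inter> pts n \<tau>)"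
proof -
  have "pts n \<sigma> \<inter> pts n \<tau> = (\<lambda>i. (i, \<sigma> i)) ` agreement n \<sigma> \<tau>"
    by (auto simp: pts_def agreement_def)
  then show ?thesis by (simp add: card_image inj_on_def)
qed

lemma swap_in_star:
  assumes \<sigma>: "\<sigma> \<in> star n (insert (a, b) S)" and a: "a \<notin> fst ` S"
    and b': "b' \<in> {1..n} - snd ` S"
  shows "transpose b b' \<circ> \<sigma> \<in> star n (insert (a, b') S)"
proof -
  from \<sigma> have p: "\<sigma> permutes {1..n}" and an: "a \<in> {1..n}" and b: "\<sigma> a = b"
    and S: "S \<subseteq> pts n \<sigma>" by (auto simp: star_def Sym_def)
  have "b \<in> {1..n}" using permutes_in_image[OF p] an b by blast
  then have q: "transpose b b' \<circ> \<sigma> permutes {1..n}"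
    using p b' by (intro permutes_compose permutes_swap_id) auto
  have "(i, j) \<in> pts n (transpose b b' \<circ> \<sigma>)" if ij: "(i, j) \<in> S" for i j
  proof -
    have "j = \<sigma> i" "i \<in> {1..n}" using S ij by auto
    moreover have "j \<noteq> b'" using b' ij by force
    moreover have "i \<noteq> a" using a ij by force
    then have "j \<noteq> b" using \<open>j = \<sigma> i\<close> b permutes_inj[OF p] by (auto simp: inj_def)
    ultimately show ?thesis by simp
  qed
  then have "S \<subseteq> pts n (transpose b b' \<circ> \<sigma>)" by (auto simp del: mem_pts)
  then show ?thesis using q an b by (simp add: star_def Sym_def)
qed

text \<open>Exchanging two unused values identifies the stars obtained by assigning either of them to \<open>a\<close>.
  This drives both the count \<open>card_star\<close> and the concentration bound \<open>star_mgf\<close>.\<close>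
lemma swap_bij_star:
  assumes a: "a \<notin> fst ` S" and b: "b \<in> {1..n} - snd ` S" and b': "b' \<in> {1..n} - snd ` S"
  shows "bij_betw (\<lambda>\<sigma>. transpose b b' \<circ> \<sigma>) (star n (insert (a, b) S)) (star n (insert (a, b') S))"
proof (rule bij_betw_byWitness[where f' = "\<lambda>\<sigma>. transpose b b' \<circ> \<sigma>"])
  show "(\<lambda>\<sigma>. transpose b b' \<circ> \<sigma>) ` star n (insert (a, b) S) \<subseteq> star n (insert (a, b') S)"
    using swap_in_star[OF _ a b'] by blast
  show "(\<lambda>\<sigma>. transpose b b' \<circ> \<sigma>) ` star n (insert (a, b') S) \<subseteq> star n (insert (a, b) S)"
    using swap_in_star[OF _ a b, of _ b'] by (auto simp: transpose_commute)
qed (auto simp: fun_eq_iff)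

lemma star_card_le: "star n S \<noteq> {} \<Longrightarrow> finite S \<and> card S \<le> n"
proof -
  assume "star n S \<noteq> {}"
  then obtain \<sigma> where S: "S \<subseteq> pts n \<sigma>" by (auto simp: star_def)
  show ?thesis using finite_subset[OF S] card_mono[OF _ S] by simp
qed

text \<open>Inductions over stars run by choosing an unassigned point \<open>a\<close> and splitting according to its
  value.\<close>
lemma star_split:
  assumes ne: "star n S \<noteq> {}" and less: "card S < n"
  obtains a where "a \<in> {1..n}" "a \<notin> fst ` S"
    "star n S = (\<Union>b\<in>{1..n} - snd ` S. star n (insert (a, b) S))"
    "card ({1..n} - snd ` S) = n - card S"
    "\<And>b. b \<in> {1..n} - snd ` S \<Longrightarrow> star n (insert (a, b) S) \<noteq> {}"
    "\<And>b b'. b \<noteq> b' \<Longrightarrow> star n (insert (a, b) S) \<inter> star n (insert (a, b') S) = {}"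
    "\<And>b. card (insert (a, b) S) = Suc (card S)"
proof -
  obtain \<rho> where \<rho>: "\<rho> permutes {1..n}" "S \<subseteq> pts n \<rho>"
    using ne by (auto simp: star_def Sym_def)
  have fin: "finite S" using star_card_le[OF ne] by simp
  have "card (fst ` S) < n" using card_image_le[OF fin, of fst] less by linarith
  then have "\<not> {1..n} \<subseteq> fst ` S" using card_mono[of "fst ` S" "{1..n}"] fin by auto
  then obtain a where a: "a \<in> {1..n}" "a \<notin> fst ` S" by blast
  have injs: "inj_on snd S"
  proof (rule inj_onI)
    fix x y assume "x \<in> S" "y \<in> S" "snd x = snd y"
    moreover have "x \<in> pts n \<rho>" "y \<in> pts n \<rho>" using \<rho>(2) \<open>x \<in> S\<close> \<open>y \<in> S\<close> by auto
    ultimately show "x = y"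
      using permutes_inj[OF \<rho>(1)] by (auto simp: pts_def inj_def)
  qed
  have subs: "snd ` S \<subseteq> {1..n}"
    using \<rho> permutes_in_image[OF \<rho>(1)] by (fastforce simp: pts_def)
  have cB: "card ({1..n} - snd ` S) = n - card S"
    using subs by (simp add: card_Diff_subset fin card_image[OF injs])
  have un: "star n S = (\<Union>b\<in>{1..n} - snd ` S. star n (insert (a, b) S))"
  proof (intro equalityI subsetI)
    fix \<sigma> assume \<sigma>: "\<sigma> \<in> star n S"
    then have p: "\<sigma> permutes {1..n}" and S: "S \<subseteq> pts n \<sigma>" by (auto simp: star_def Sym_def)
    have "\<sigma> a \<notin> snd ` S"
    proof
      assume "\<sigma> a \<in> snd ` S"
      then obtain i where i: "(i, \<sigma> a) \<in> S" by force
      then have "\<sigma> a = \<sigma> i" using S by auto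
      then have "a = i" using permutes_inj[OF p] by (auto simp: inj_def)
      then show False using a i by force
    qed
    moreover have "\<sigma> a \<in> {1..n}" using permutes_in_image[OF p] a by blast
    ultimately show "\<sigma> \<in> (\<Union>b\<in>{1..n} - snd ` S. star n (insert (a, b) S))"
      using \<sigma> a by (auto simp: star_def intro!: bexI[of _ "\<sigma> a"])
  qed (auto simp: star_def)
  have dis: "star n (insert (a, b) S) \<inter> star n (insert (a, b') S) = {}" if "b \<noteq> b'" for b b'
    using that by (auto simp: star_def)
  have "(\<Union>b\<in>{1..n} - snd ` S. star n (insert (a, b) S)) \<noteq> {}" using un ne by simp
  then obtain b0 where b0: "b0 \<in> {1..n} - snd ` S" "star n (insert (a, b0) S) \<noteq> {}" by blast
  have nn: "star n (insert (a, b) S) \<noteq> {}" if "b \<in> {1..n} - snd ` S" for b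
    using swap_bij_star[OF a(2) b0(1) that] b0(2) by (auto simp: bij_betw_def)
  have ci: "card (insert (a, b) S) = Suc (card S)" for b
    using a fin by (subst card_insert_disjoint) force+
  show ?thesis by (rule that[OF a un cB nn dis ci])
qed

lemma card_star:
  assumes "star n S \<noteq> {}"
  shows "card (star n S) = fact (n - card S)"
  using assms
proof (induction "n - card S" arbitrary: S)
  case 0
  have cS: "card S = n" using star_card_le[OF 0(2)] 0(1) by linarith
  obtain \<rho> where \<rho>: "\<rho> \<in> star n S" using 0(2) by blast
  have "\<sigma> = \<rho>" if "\<sigma> \<in> star n S" for \<sigma>
  proof -
    have S: "S = pts n \<tau>" if "\<tau> \<in> star n S" for \<tau>
    proof (rule card_subset_eq)
      show "S \<subseteq> pts n \<tau>" using that by (simp add: star_def)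
    qed (simp_all add: cS)
    have "pts n \<sigma> = pts n \<rho>" using S[OF that] S[OF \<rho>] by simp
    then have "\<forall>i\<in>{1..n}. \<sigma> i = \<rho> i" by (auto simp: pts_def)
    moreover have "\<sigma> permutes {1..n}" "\<rho> permutes {1..n}"
      using that \<rho> by (auto simp: star_def Sym_def)
    ultimately show ?thesis by (metis ext permutes_not_in)
  qed
  then have "star n S = {\<rho>}" using \<rho> by blast
  then show ?case using cS by simp
next
  case (Suc k)
  have k: "n - Suc (card S) = k" using Suc.hyps(2) by linarith
  obtain a where a: "star n S = (\<Union>b\<in>{1..n} - snd ` S. star n (insert (a, b) S))"
    "card ({1..n} - snd ` S) = n - card S"
    "\<And>b. b \<in> {1..n} - snd ` S \<Longrightarrow> star n (insert (a, b) S) \<noteq> {}"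
    "\<And>b b'. b \<noteq> b' \<Longrightarrow> star n (insert (a, b) S) \<inter> star n (insert (a, b') S) = {}"
    "\<And>b. card (insert (a, b) S) = Suc (card S)"
    using star_split[OF Suc.prems] Suc.hyps(2) by (metis zero_less_Suc zero_less_diff)
  have "card (star n S) = (\<Sum>b\<in>{1..n} - snd ` S. card (star n (insert (a, b) S)))"
    unfolding a(1) by (intro card_UN_disjoint) (use a(4) in auto)
  also have "\<dots> = (\<Sum>b\<in>{1..n} - snd ` S. fact k)"
    using Suc.hyps(1)[OF _ a(3)] by (intro sum.cong refl) (simp add: a(5) k)
  also have "\<dots> = fact (n - card S)"
    using a(2) Suc.hyps(2)[symmetric] by simp
  finally show ?case .
qed

section \<open>Concentration on stars\<close>

lemma exp_le_quadratic:
  fixes x :: real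
  assumes "\<bar>x\<bar> \<le> 1"
  shows "exp x \<le> 1 + x + x\<^sup>2"
proof (cases "x \<ge> 0")
  case True
  then show ?thesis using exp_bound assms by simp
next
  case False
  define y where "y = - x"
  have y: "0 \<le> y" "y \<le> 1" using False assms by (auto simp: y_def)
  have "exp x * exp y = 1" by (simp add: y_def flip: exp_add)
  moreover have "exp x * (1 + y) \<le> exp x * exp y"
    using exp_ge_add_one_self[of y] by (intro mult_left_mono) auto
  ultimately have "exp x * (1 + y) \<le> 1" by simp
  also have "1 \<le> (1 - y + y\<^sup>2) * (1 + y)"
    using y by (simp add: algebra_simps power2_eq_square)
  finally have "exp x \<le> 1 - y + y\<^sup>2" using y by (simp add: mult_le_cancel_right)
  then show ?thesis by (simp add: y_def)
qed

text \<open>A martingale argument in the style of Azuma and Hoeffding, which reveals the values of a random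
  permutation one at a time. By \<open>swap_bij_star\<close> the conditional averages after revealing one more
  value differ pairwise by at most \<open>c\<close>, so by \<open>exp_le_quadratic\<close> each step costs a factor of at most
  \<open>1 + c\<^sup>2 \<le> exp (c\<^sup>2)\<close>: the linear terms cancel.\<close>
lemma star_mgf:
  fixes f :: "(nat \<Rightarrow> nat) \<Rightarrow> real"
  assumes lip: "\<And>\<sigma> b b'. \<lbrakk>\<sigma> \<in> Sym n; b \<in> {1..n}; b' \<in> {1..n}\<rbrakk>
      \<Longrightarrow> \<bar>f \<sigma> - f (transpose b b' \<circ> \<sigma>)\<bar> \<le> c"
    and c: "0 \<le> c" "c \<le> 1" and ne: "star n S \<noteq> {}"
  shows "(\<Sum>\<sigma>\<in>star n S. exp (f \<sigma> - (\<Sum>\<tau>\<in>star n S. f \<tau>) / card (star n S)))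
    \<le> card (star n S) * exp (real (n - card S) * c\<^sup>2)"
  using ne
proof (induction "n - card S" arbitrary: S)
  case 0
  have "card (star n S) = 1" using card_star[OF 0(2)] by (simp flip: 0(1))
  then obtain \<rho> where "star n S = {\<rho>}" by (auto simp: card_1_singleton_iff)
  then show ?case by simp
next
  case (Suc k)
  have k: "n - Suc (card S) = k" using Suc.hyps(2) by linarith
  define B where "B = {1..n} - snd ` S"
  define m where "m T = (\<Sum>\<tau>\<in>star n T. f \<tau>) / card (star n T)" for T
  obtain a where a: "a \<notin> fst ` S" "star n S = (\<Union>b\<in>B. star n (insert (a, b) S))"
    "card B = n - card S"
    "\<And>b. b \<in> B \<Longrightarrow> star n (insert (a, b) S) \<noteq> {}"
    "\<And>b b'. b \<noteq> b' \<Longrightarrow> star n (insert (a, b) S) \<inter> star n (insert (a, b') S) = {}"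
    "\<And>b. card (insert (a, b) S) = Suc (card S)"
    unfolding B_def
    using star_split[OF Suc.prems] Suc.hyps(2) by (metis zero_less_Suc zero_less_diff)
  define N :: real where "N = fact k"
  have N: "N > 0" by (simp add: N_def)
  have finB: "finite B" by (simp add: B_def)
  have cN: "real (card (star n (insert (a, b) S))) = N" if "b \<in> B" for b
    using card_star[OF a(4)[OF that]] by (simp add: a(6) k N_def)
  have split: "(\<Sum>\<sigma>\<in>star n S. g \<sigma>) = (\<Sum>b\<in>B. \<Sum>\<sigma>\<in>star n (insert (a, b) S). g \<sigma>)"
    for g :: "_ \<Rightarrow> real"
    unfolding a(2) by (intro sum.UNION_disjoint) (use a(5) finB in auto)
  have cB: "card B = Suc k" using a(3) Suc.hyps(2) by simp
  have cS: "real (card (star n S)) = card B * N"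
    using card_star[OF Suc.prems] cB Suc.hyps(2)[symmetric] by (simp add: N_def algebra_simps)
  let ?m = "\<lambda>b. m (insert (a, b) S)"
  have sumf: "(\<Sum>\<tau>\<in>star n (insert (a, b) S). f \<tau>) = N * ?m b" if "b \<in> B" for b
    unfolding m_def using cN[OF that] N by simp
  have mS: "card B * m S = (\<Sum>b\<in>B. ?m b)"
  proof -
    have "(\<Sum>\<tau>\<in>star n S. f \<tau>) = N * (\<Sum>b\<in>B. ?m b)"
      unfolding split by (simp add: sumf sum_distrib_left)
    then have "m S = N * (\<Sum>b\<in>B. ?m b) / (card B * N)" by (simp only: m_def[of S] cS)
    then show ?thesis using N cB by simp
  qed
  have mm: "\<bar>?m b - ?m b'\<bar> \<le> c" if bb: "b \<in> B" "b' \<in> B" for b b'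
  proof -
    have "bij_betw (\<lambda>\<sigma>. transpose b b' \<circ> \<sigma>) (star n (insert (a, b) S)) (star n (insert (a, b') S))"
      using swap_bij_star[OF a(1)] bb by (simp add: B_def)
    from sum.reindex_bij_betw[OF this, of f]
    have "N * ?m b' = (\<Sum>\<tau>\<in>star n (insert (a, b) S). f (transpose b b' \<circ> \<tau>))"
      by (simp add: sumf[OF bb(2)])
    then have "N * (?m b - ?m b') =
        (\<Sum>\<tau>\<in>star n (insert (a, b) S). f \<tau> - f (transpose b b' \<circ> \<tau>))"
      by (simp add: sumf[OF bb(1), symmetric] sum_subtractf right_diff_distrib)
    also have "\<bar>\<dots>\<bar> \<le> (\<Sum>\<tau>\<in>star n (insert (a, b) S). c)"
      using bb star_subset_Sym
      by (intro order_trans[OF sum_abs] sum_mono lip) (auto simp: B_def)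
    also have "\<dots> = N * c" using cN[OF bb(1)] by simp
    finally show ?thesis using N by (simp add: abs_mult)
  qed
  have md: "\<bar>?m b - m S\<bar> \<le> c" if b: "b \<in> B" for b
  proof -
    have "card B * (?m b - m S) = (\<Sum>b'\<in>B. ?m b - ?m b')"
      using mS by (simp add: right_diff_distrib sum_subtractf)
    also have "\<bar>\<dots>\<bar> \<le> (\<Sum>b'\<in>B. c)"
      by (intro order_trans[OF sum_abs] sum_mono mm b)
    finally show ?thesis using cB by (simp add: abs_mult)
  qed
  have "(\<Sum>\<sigma>\<in>star n S. exp (f \<sigma> - m S))
      = (\<Sum>b\<in>B. exp (?m b - m S) * (\<Sum>\<sigma>\<in>star n (insert (a, b) S). exp (f \<sigma> - ?m b)))"
    unfolding split sum_distrib_left by (intro sum.cong refl) (simp flip: exp_add)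
  also have "\<dots> \<le> (\<Sum>b\<in>B. exp (?m b - m S) * (N * exp (real k * c\<^sup>2)))"
  proof (intro sum_mono mult_left_mono)
    fix b assume b: "b \<in> B"
    have "n - card (insert (a, b) S) = k" using a(6) Suc.hyps(2) by simp
    then show "(\<Sum>\<sigma>\<in>star n (insert (a, b) S). exp (f \<sigma> - ?m b)) \<le> N * exp (real k * c\<^sup>2)"
      using Suc.hyps(1)[OF _ a(4)[OF b]] cN[OF b] by (simp add: m_def)
  qed simp
  also have "\<dots> = N * exp (real k * c\<^sup>2) * (\<Sum>b\<in>B. exp (?m b - m S))"
    by (simp add: sum_distrib_left mult_ac)
  also have "(\<Sum>b\<in>B. exp (?m b - m S)) \<le> (\<Sum>b\<in>B. 1 + (?m b - m S) + c\<^sup>2)"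
  proof (intro sum_mono)
    fix b assume b: "b \<in> B"
    have "(?m b - m S)\<^sup>2 \<le> c\<^sup>2" using md[OF b] c by (simp add: abs_le_square_iff[symmetric])
    then show "exp (?m b - m S) \<le> 1 + (?m b - m S) + c\<^sup>2"
      using exp_le_quadratic[of "?m b - m S"] md[OF b] c by linarith
  qed
  also have "\<dots> = card B * (1 + c\<^sup>2)"
    using mS by (simp add: sum.distrib sum_subtractf algebra_simps)
  also have "\<dots> \<le> card B * exp (c\<^sup>2)"
    by (intro mult_left_mono) auto
  finally have "(\<Sum>\<sigma>\<in>star n S. exp (f \<sigma> - m S))
      \<le> N * exp (real k * c\<^sup>2) * (card B * exp (c\<^sup>2))"
    using N by (simp add: mult_left_mono)
  also have "\<dots> = card (star n S) * exp (real (n - card S) * c\<^sup>2)"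
    unfolding cS Suc.hyps(2)[symmetric] by (simp add: algebra_simps exp_add)
  finally show ?case unfolding m_def .
qed

text \<open>An entropy bound: passing from the star to a subfamily of density \<open>1 / L\<close> multiplies the
  exponential moment by at most \<open>L\<close>, and by Jensen's inequality this moves the average of \<open>f\<close> by at
  most \<open>ln L / l\<close>, in addition to the term \<open>n * l * c\<^sup>2\<close> that comes from \<open>star_mgf\<close>. The parameter \<open>l\<close> is free to be optimised.\<close>
lemma dense_subfamily_average_le:
  fixes f :: "(nat \<Rightarrow> nat) \<Rightarrow> real" and L l c :: real
  assumes lip: "\<And>\<sigma> b b'. \<lbrakk>\<sigma> \<in> Sym n; b \<in> {1..n}; b' \<in> {1..n}\<rbrakk>
      \<Longrightarrow> \<bar>f \<sigma> - f (transpose b b' \<circ> \<sigma>)\<bar> \<le> c"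
    and c: "0 \<le> c" and l: "0 < l" "l * c \<le> 1"
    and G: "G \<subseteq> star n S" "G \<noteq> {}" and L: "card (star n S) \<le> L * card G" and L0: "L > 0"
  shows "(\<Sum>\<sigma>\<in>G. f \<sigma>) / card G
    \<le> (\<Sum>\<sigma>\<in>star n S. f \<sigma>) / card (star n S) + ln L / l + n * l * c\<^sup>2"
proof -
  define M where "M = (\<Sum>\<sigma>\<in>star n S. f \<sigma>) / card (star n S)"
  define a where "a = l * ((\<Sum>\<sigma>\<in>G. f \<sigma>) / card G - M)"
  have finG: "finite G" using G(1) finite_star finite_subset by blast
  have cG: "real (card G) > 0" using finG G(2) by (simp add: card_gt_0_iff)
  have ne: "star n S \<noteq> {}" using G by blast
  \<comment> \<open>Jensen's inequality, from the tangent of the exponential at the average \<open>a\<close>\<close>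
  have "(\<Sum>\<sigma>\<in>G. 1 + (l * (f \<sigma> - M) - a))
      = card G + (l * ((\<Sum>\<sigma>\<in>G. f \<sigma>) - card G * M) - card G * a)"
    by (simp add: sum.distrib sum_subtractf sum_distrib_left[symmetric])
  also have "l * ((\<Sum>\<sigma>\<in>G. f \<sigma>) - card G * M) = card G * a"
    using cG by (simp add: a_def field_simps)
  finally have "(\<Sum>\<sigma>\<in>G. 1 + (l * (f \<sigma> - M) - a)) = card G" by simp
  then have "real (card G) \<le> (\<Sum>\<sigma>\<in>G. exp (l * (f \<sigma> - M) - a))"
    by (metis (no_types, lifting) exp_ge_add_one_self sum_mono)
  also have "\<dots> = exp (- a) * (\<Sum>\<sigma>\<in>G. exp (l * f \<sigma> - l * M))"
    unfolding sum_distrib_left by (intro sum.cong refl) (simp add: right_diff_distrib flip: exp_add)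
  also have "(\<Sum>\<sigma>\<in>G. exp (l * f \<sigma> - l * M)) \<le> (\<Sum>\<sigma>\<in>star n S. exp (l * f \<sigma> - l * M))"
    by (intro sum_mono2 G) auto
  also have "\<dots> \<le> card (star n S) * exp (real (n - card S) * (l * c)\<^sup>2)"
  proof -
    have "\<bar>l * f \<sigma> - l * f (transpose b b' \<circ> \<sigma>)\<bar> \<le> l * c"
      if "\<sigma> \<in> Sym n" "b \<in> {1..n}" "b' \<in> {1..n}" for \<sigma> b b'
      using mult_left_mono[OF lip[OF that], of l] l
      by (simp add: abs_mult right_diff_distrib[symmetric])
    from star_mgf[of n "\<lambda>\<sigma>. l * f \<sigma>", OF this _ l(2) ne] show ?thesis
      using l c by (simp add: M_def sum_distrib_left[symmetric])
  qed
  also have "\<dots> \<le> (L * card G) * exp (n * (l * c)\<^sup>2)"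
    using L0 by (intro mult_mono L) (auto intro!: mult_right_mono)
  finally have "card G \<le> exp (- a) * (L * card G * exp (n * (l * c)\<^sup>2))" by simp
  then have "real (card G) * 1 \<le> real (card G) * (exp (- a) * L * exp (n * (l * c)\<^sup>2))"
    by (simp only: mult_ac mult_1_right)
  then have "1 \<le> exp (- a) * L * exp (n * (l * c)\<^sup>2)"
    using cG mult_le_cancel_left_pos by blast
  then have "exp a * 1 \<le> exp a * (exp (- a) * L * exp (n * (l * c)\<^sup>2))"
    by (intro mult_left_mono) auto
  also have "\<dots> = exp (ln L + n * (l * c)\<^sup>2)"
    using L0 by (simp add: exp_add exp_minus)
  finally have "exp a \<le> exp (ln L + n * (l * c)\<^sup>2)" by simp
  then have "a \<le> ln L + n * (l * c)\<^sup>2" by simp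
  then show ?thesis
    using l(1) by (simp add: a_def M_def[symmetric] field_simps power2_eq_square)
qed

section \<open>Proportions of a family containing given cells\<close>

definition matchings :: "nat \<Rightarrow> nat \<Rightarrow> (nat \<times> nat) set set" where
  "matchings n k = {X. card X = k \<and> (\<exists>\<sigma>\<in>Sym n. X \<subseteq> pts n \<sigma>)}"

text \<open>Only cells outside \<open>S\<close> count, since all members of a family inside the star of \<open>S\<close> share the
  cells of \<open>S\<close>; in particular the value is 0 if \<open>X\<close> meets \<open>S\<close>.\<close>
definition link :: "nat \<Rightarrow> (nat \<times> nat) set \<Rightarrow> (nat \<Rightarrow> nat) set \<Rightarrow> (nat \<times> nat) set \<Rightarrow> real" where
  "link n S G X = card {\<sigma> \<in> G. X \<subseteq> pts n \<sigma> - S} / card G"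

lemma link_nonneg [simp]: "0 \<le> link n S G X"
  by (simp add: link_def)

lemma finite_matchings [simp]: "finite (matchings n k)"
proof (rule finite_subset)
  show "matchings n k \<subseteq> (\<Union>\<sigma>\<in>Sym n. Pow (pts n \<sigma>))"
    by (auto simp: matchings_def simp del: mem_pts)
qed simp

lemma sum_matchings_swap:
  fixes w :: "_ \<Rightarrow> real"
  assumes G: "G \<subseteq> Sym n"
  shows "(\<Sum>X\<in>matchings n k. w X * card {\<sigma> \<in> G. X \<subseteq> pts n \<sigma> - S})
    = (\<Sum>\<sigma>\<in>G. \<Sum>X | X \<subseteq> pts n \<sigma> - S \<and> card X = k. w X)"
proof -
  have fin: "finite G" using G finite_subset finite_Sym by blast
  have "(\<Sum>X\<in>matchings n k. w X * card {\<sigma> \<in> G. X \<subseteq> pts n \<sigma> - S})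
      = (\<Sum>X\<in>matchings n k. \<Sum>\<sigma>\<in>G. if X \<subseteq> pts n \<sigma> - S then w X else 0)"
    using fin by (intro sum.cong refl) (simp add: sum.inter_filter[symmetric] mult.commute)
  also have "\<dots> = (\<Sum>\<sigma>\<in>G. \<Sum>X\<in>matchings n k. if X \<subseteq> pts n \<sigma> - S then w X else 0)"
    by (rule sum.swap)
  also have "\<dots> = (\<Sum>\<sigma>\<in>G. \<Sum>X | X \<subseteq> pts n \<sigma> - S \<and> card X = k. w X)"
  proof (rule sum.cong[OF refl])
    fix \<sigma> assume "\<sigma> \<in> G"
    then have "{X \<in> matchings n k. X \<subseteq> pts n \<sigma> - S} = {X. X \<subseteq> pts n \<sigma> - S \<and> card X = k}"
      using G by (auto simp: matchings_def simp del: mem_pts)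
    then show "(\<Sum>X\<in>matchings n k. if X \<subseteq> pts n \<sigma> - S then w X else 0)
        = (\<Sum>X | X \<subseteq> pts n \<sigma> - S \<and> card X = k. w X)"
      by (simp add: sum.inter_filter[symmetric])
  qed
  finally show ?thesis .
qed

text \<open>Double counting. Taking \<open>w\<close> to be a link function turns correlations of two families into
  averages over one of them.\<close>
lemma sum_mult_link:
  fixes w :: "_ \<Rightarrow> real"
  assumes "G \<subseteq> Sym n"
  shows "(\<Sum>X\<in>matchings n k. w X * link n S G X)
    = (\<Sum>\<sigma>\<in>G. \<Sum>X | X \<subseteq> pts n \<sigma> - S \<and> card X = k. w X) / card G"
  unfolding sum_matchings_swap[OF assms, symmetric] link_def by (simp add: sum_divide_distrib)

lemma card_pts_Diff: "\<sigma> \<in> star n S \<Longrightarrow> card (pts n \<sigma> - S) = n - card S"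
  using finite_subset[OF _ finite_pts, of S n \<sigma>] by (simp add: star_def card_Diff_subset)

lemma sum_link:
  assumes G: "G \<subseteq> star n S" "G \<noteq> {}"
  shows "(\<Sum>X\<in>matchings n k. link n S G X) = (n - card S) choose k"
proof -
  have GS: "G \<subseteq> Sym n" using G star_subset_Sym by blast
  have fin: "card G > 0" using G finite_subset[OF G(1) finite_star] by (simp add: card_gt_0_iff)
  have "(\<Sum>X\<in>matchings n k. link n S G X)
      = (\<Sum>\<sigma>\<in>G. real (card {X. X \<subseteq> pts n \<sigma> - S \<and> card X = k})) / card G"
    using sum_mult_link[OF GS, of "\<lambda>_. 1" S k] by simp
  also have "(\<Sum>\<sigma>\<in>G. real (card {X. X \<subseteq> pts n \<sigma> - S \<and> card X = k}))
      = (\<Sum>\<sigma>\<in>G. real ((n - card S) choose k))"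
    using G(1) by (intro sum.cong refl) (simp add: n_subsets card_pts_Diff subsetD)
  finally show ?thesis using fin by simp
qed

lemma card_matchings:
  assumes "k \<le> n"
  shows "real (card (matchings n k)) = (n choose k) * fact n / fact (n - k)"
proof -
  have "card {\<sigma> \<in> Sym n. X \<subseteq> pts n \<sigma> - {}} = (fact (n - k) :: real)"
    if "X \<in> matchings n k" for X
  proof -
    have "star n X \<noteq> {}" "card X = k" using that by (auto simp: matchings_def star_def)
    then show ?thesis using card_star[of n X] by (simp add: star_def)
  qed
  then have "card (matchings n k) * fact (n - k)
      = (\<Sum>X\<in>matchings n k. 1 * real (card {\<sigma> \<in> Sym n. X \<subseteq> pts n \<sigma> - {}}))"
    by simp
  also have "\<dots> = (\<Sum>\<sigma>\<in>Sym n. \<Sum>X | X \<subseteq> pts n \<sigma> - {} \<and> card X = k. 1)"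
    by (rule sum_matchings_swap) simp
  also have "\<dots> = fact n * (n choose k)"
    by (simp add: n_subsets card_Sym)
  finally show ?thesis by (simp add: field_simps)
qed

lemma link_star_le:
  assumes "k = card X"
  shows "link n S (star n S) X \<le> fact (n - card S - k) / fact (n - card S)"
proof (cases "{\<sigma> \<in> star n S. X \<subseteq> pts n \<sigma> - S} = {}")
  case True
  then show ?thesis by (simp only: link_def) simp
next
  case False
  then obtain \<sigma> where \<sigma>: "\<sigma> \<in> star n S" "X \<subseteq> pts n \<sigma> - S" by blast
  then have fX: "finite X" and fS: "finite S" and ne: "star n S \<noteq> {}"
    using finite_subset[OF _ finite_pts, of X n \<sigma>] star_card_le[of n S] by blast+
  have eq: "{\<sigma> \<in> star n S. X \<subseteq> pts n \<sigma> - S} = star n (S \<union> X)"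
    using \<sigma> by (auto simp: star_def simp del: mem_pts)
  have "card (S \<union> X) = card S + k"
    using \<sigma> fX fS assms by (subst card_Un_disjoint) auto
  then have "card (star n (S \<union> X)) = fact (n - card S - k)"
    using card_star[of n "S \<union> X"] False eq by simp
  then show ?thesis using card_star[OF ne] eq by (simp add: link_def)
qed

lemma card_subsets_containing_le:
  assumes "finite A" "x \<in> A" "k \<ge> 1"
  shows "card {X. X \<subseteq> A \<and> card X = k \<and> x \<in> X} \<le> card A ^ (k - 1)"
proof -
  have "{X. X \<subseteq> A \<and> card X = k \<and> x \<in> X} \<subseteq> insert x ` {Y. Y \<subseteq> A - {x} \<and> card Y = k - 1}"
  proof
    fix X assume X: "X \<in> {X. X \<subseteq> A \<and> card X = k \<and> x \<in> X}"
    then have "finite X" using assms finite_subset by blast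
    then show "X \<in> insert x ` {Y. Y \<subseteq> A - {x} \<and> card Y = k - 1}"
      using X by (intro image_eqI[of _ _ "X - {x}"]) auto
  qed
  then have "card {X. X \<subseteq> A \<and> card X = k \<and> x \<in> X}
      \<le> card {Y. Y \<subseteq> A - {x} \<and> card Y = k - 1}"
    using assms by (intro surj_card_le) auto
  also have "\<dots> = (card A - 1) choose (k - 1)"
    using assms by (simp add: n_subsets)
  also have "\<dots> \<le> (card A - 1) ^ (k - 1)"
    by (cases "k - 1 \<le> card A - 1") (simp_all add: binomial_le_pow binomial_eq_0)
  also have "\<dots> \<le> card A ^ (k - 1)" by (intro power_mono) auto
  finally show ?thesis .
qed

lemma card_pts_swap_le:
  assumes "\<sigma> \<in> Sym n"
  shows "card (pts n \<sigma> - pts n (transpose b b' \<circ> \<sigma>)) \<le> 2"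
proof -
  have inj: "inj \<sigma>" using assms by (simp add: Sym_def permutes_inj)
  have "snd ` (pts n \<sigma> - pts n (transpose b b' \<circ> \<sigma>)) \<subseteq> {b, b'}"
    by (auto simp: pts_def transpose_def split: if_splits)
  then have "card (snd ` (pts n \<sigma> - pts n (transpose b b' \<circ> \<sigma>))) \<le> card {b, b'}"
    by (intro card_mono) auto
  also have "\<dots> \<le> 2" by (simp add: card_insert_if)
  also have "card (snd ` (pts n \<sigma> - pts n (transpose b b' \<circ> \<sigma>)))
      = card (pts n \<sigma> - pts n (transpose b b' \<circ> \<sigma>))"
    using inj by (intro card_image) (auto simp: inj_on_def pts_def inj_def)
  finally show ?thesis .
qed

text \<open>Composing with a transposition changes at most two cells of \<open>\<sigma>\<close>, and at most
  \<open>n ^ (k - 1)\<close> of the \<open>k\<close>-subsets of \<open>\<sigma>\<close> contain a given cell.\<close>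
lemma subset_sum_swap_diff_le:
  fixes w :: "_ \<Rightarrow> real"
  assumes \<sigma>: "\<sigma> \<in> Sym n" and k: "k \<ge> 1" and w: "\<And>X. 0 \<le> w X"
    and M: "\<And>X. X \<in> matchings n k \<Longrightarrow> w X \<le> M" and M0: "0 \<le> M"
  shows "(\<Sum>X | X \<subseteq> pts n \<sigma> - S \<and> card X = k. w X)
    - (\<Sum>X | X \<subseteq> pts n (transpose b b' \<circ> \<sigma>) - S \<and> card X = k. w X) \<le> 2 * real n ^ (k - 1) * M"
    (is "sum w ?A - sum w ?B \<le> _")
proof -
  define D where "D = pts n \<sigma> - pts n (transpose b b' \<circ> \<sigma>)"
  have finA: "finite ?A" "finite ?B" by (rule finite_subset[of _ "Pow (pts n _)"]; force)+
  have inM: "X \<in> matchings n k" if "X \<subseteq> pts n \<sigma>" "card X = k" for X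
    using that \<sigma> by (auto simp: matchings_def)
  have "sum w ?A = sum w (?A \<inter> ?B) + sum w (?A - ?B)"
    by (rule sum.Int_Diff[OF finA(1)])
  moreover have "sum w (?A \<inter> ?B) \<le> sum w ?B"
    using finA w by (intro sum_mono2) auto
  moreover have "sum w (?A - ?B) \<le> 2 * real n ^ (k - 1) * M"
  proof -
    have "sum w (?A - ?B) \<le> sum w (\<Union>x\<in>D. {X. X \<subseteq> pts n \<sigma> \<and> card X = k \<and> x \<in> X})"
    proof (rule sum_mono2)
      show "finite (\<Union>x\<in>D. {X. X \<subseteq> pts n \<sigma> \<and> card X = k \<and> x \<in> X})"
      proof (rule finite_subset)
        show "(\<Union>x\<in>D. {X. X \<subseteq> pts n \<sigma> \<and> card X = k \<and> x \<in> X}) \<subseteq> Pow (pts n \<sigma>)" by blast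
      qed simp
      show "?A - ?B \<subseteq> (\<Union>x\<in>D. {X. X \<subseteq> pts n \<sigma> \<and> card X = k \<and> x \<in> X})"
      proof
        fix X assume X: "X \<in> ?A - ?B"
        then have "\<not> X \<subseteq> pts n (transpose b b' \<circ> \<sigma>)" by blast
        then obtain x where "x \<in> X" "x \<notin> pts n (transpose b b' \<circ> \<sigma>)" by blast
        moreover have "X \<subseteq> pts n \<sigma>" "card X = k" using X by blast+
        ultimately show "X \<in> (\<Union>x\<in>D. {X. X \<subseteq> pts n \<sigma> \<and> card X = k \<and> x \<in> X})"
          unfolding D_def by blast
      qed
    qed (rule w)
    also have "\<dots> \<le> (\<Sum>X\<in>(\<Union>x\<in>D. {X. X \<subseteq> pts n \<sigma> \<and> card X = k \<and> x \<in> X}). M)"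
      by (intro sum_mono M inM) auto
    also have "\<dots> = card (\<Union>x\<in>D. {X. X \<subseteq> pts n \<sigma> \<and> card X = k \<and> x \<in> X}) * M"
      by simp
    also have "\<dots> \<le> 2 * real n ^ (k - 1) * M"
    proof (intro mult_right_mono[OF _ M0])
      have "card (\<Union>x\<in>D. {X. X \<subseteq> pts n \<sigma> \<and> card X = k \<and> x \<in> X})
          \<le> (\<Sum>x\<in>D. card {X. X \<subseteq> pts n \<sigma> \<and> card X = k \<and> x \<in> X})"
        by (rule card_UN_le) (simp add: D_def)
      also have "\<dots> \<le> (\<Sum>x\<in>D. n ^ (k - 1))"
        using card_subsets_containing_le[OF finite_pts _ k, of _ n \<sigma>]
        by (intro sum_mono) (auto simp: D_def simp del: mem_pts)
      also have "\<dots> = card D * n ^ (k - 1)" by simp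
      also have "\<dots> \<le> 2 * n ^ (k - 1)"
        using card_pts_swap_le[OF \<sigma>] by (simp add: D_def)
      finally have "real (card (\<Union>x\<in>D. {X. X \<subseteq> pts n \<sigma> \<and> card X = k \<and> x \<in> X}))
          \<le> real (2 * n ^ (k - 1))" by (rule of_nat_mono)
      then show "real (card (\<Union>x\<in>D. {X. X \<subseteq> pts n \<sigma> \<and> card X = k \<and> x \<in> X}))
          \<le> 2 * real n ^ (k - 1)" by simp
    qed
    finally show ?thesis .
  qed
  ultimately show ?thesis by linarith
qed


text \<open>The left hand side is the average over \<open>G\<close> of the function \<open>f\<close> that adds up \<open>link n S G\<close>
  over the \<open>k\<close>-subsets of a permutation. Over the whole star this function has average at most
  \<open>1 / fact k\<close>, and it is Lipschitz because \<open>link n S G\<close> is bounded by \<open>M\<close>, so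
  \<open>dense_subfamily_average_le\<close> applies.\<close>
lemma sum_link_sq_le:
  fixes L l M :: real
  assumes G: "G \<subseteq> star n S" "G \<noteq> {}" and L: "card (star n S) \<le> L * card G" "L > 0"
    and k: "k \<ge> 1" and M: "\<And>X. X \<in> matchings n k \<Longrightarrow> link n S G X \<le> M" "0 \<le> M"
    and l: "0 < l" "l * (2 * real n ^ (k - 1) * M) \<le> 1"
  shows "(\<Sum>X\<in>matchings n k. (link n S G X)\<^sup>2)
    \<le> 1 / fact k + ln L / l + n * l * (2 * real n ^ (k - 1) * M)\<^sup>2"
proof -
  define f where "f \<sigma> = (\<Sum>X | X \<subseteq> pts n \<sigma> - S \<and> card X = k. link n S G X)" for \<sigma>
  let ?c = "2 * real n ^ (k - 1) * M"
  have GS: "G \<subseteq> Sym n" using G star_subset_Sym by blast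
  have lip: "\<bar>f \<sigma> - f (transpose b b' \<circ> \<sigma>)\<bar> \<le> ?c"
    if \<sigma>: "\<sigma> \<in> Sym n" "b \<in> {1..n}" "b' \<in> {1..n}" for \<sigma> b b'
  proof -
    define \<tau> where "\<tau> = transpose b b' \<circ> \<sigma>"
    have "\<sigma> permutes {1..n}" using \<sigma>(1) by (simp add: Sym_def)
    from permutes_compose[OF this permutes_swap_id[OF \<sigma>(2,3)]]
    have \<tau>: "\<tau> \<in> Sym n" unfolding Sym_def \<tau>_def by simp
    have inv: "transpose b b' \<circ> \<tau> = \<sigma>" by (auto simp: \<tau>_def fun_eq_iff)
    have "f \<sigma> - f \<tau> \<le> ?c" unfolding f_def \<tau>_def
      by (rule subset_sum_swap_diff_le[OF \<sigma>(1) k link_nonneg M])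
    moreover have "f \<tau> - f (transpose b b' \<circ> \<tau>) \<le> ?c" unfolding f_def
      by (rule subset_sum_swap_diff_le[OF \<tau> k link_nonneg M])
    ultimately have "\<bar>f \<sigma> - f \<tau>\<bar> \<le> ?c" unfolding inv by linarith
    then show ?thesis unfolding \<tau>_def .
  qed
  have "(\<Sum>X\<in>matchings n k. (link n S G X)\<^sup>2) = (\<Sum>\<sigma>\<in>G. f \<sigma>) / card G"
    unfolding power2_eq_square f_def by (rule sum_mult_link[OF GS])
  also have "\<dots> \<le> (\<Sum>\<sigma>\<in>star n S. f \<sigma>) / card (star n S) + ln L / l + n * l * ?c\<^sup>2"
    using dense_subfamily_average_le[where f = f, OF lip _ l G L] M(2) by simp
  also have "(\<Sum>\<sigma>\<in>star n S. f \<sigma>) / card (star n S)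
      = (\<Sum>X\<in>matchings n k. link n S G X * link n S (star n S) X)"
    unfolding f_def by (rule sum_mult_link[OF star_subset_Sym, symmetric])
  also have "\<dots> \<le> (\<Sum>X\<in>matchings n k.
      link n S G X * (fact (n - card S - k) / fact (n - card S)))"
    by (intro sum_mono mult_left_mono link_star_le) (auto simp: matchings_def)
  also have "\<dots> = ((n - card S) choose k) * (fact (n - card S - k) / fact (n - card S))"
    by (simp only: sum_distrib_right[symmetric] sum_link[OF G])
  also have "\<dots> \<le> 1 / fact k"
    by (cases "k \<le> n - card S") (simp_all add: binomial_fact binomial_eq_0)
  finally show ?thesis by simp
qed

lemma power_diff_mult_fact_le:
  assumes "k \<le> m"
  shows "real (m - k) ^ k * fact (m - k) \<le> fact m"
  using assms
proof (induction k)
  case (Suc k)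
  have eq: "m - k = Suc (m - Suc k)" using Suc.prems by simp
  have "real (m - Suc k) ^ Suc k * fact (m - Suc k)
      = real (m - Suc k) ^ k * (real (m - Suc k) * fact (m - Suc k))" by simp
  also have "\<dots> \<le> real (m - k) ^ k * (real (m - k) * fact (m - Suc k))"
    using Suc.prems by (intro mult_mono power_mono mult_nonneg_nonneg) auto
  also have "real (m - k) * fact (m - Suc k) = fact (m - k)" by (subst (2) eq) (simp add: eq)
  also have "real (m - k) ^ k * fact (m - k) \<le> fact m" using Suc by simp
  finally show ?case .
qed simp

lemma fact_le_power_mult_fact:
  assumes "k \<le> n"
  shows "(fact n :: real) \<le> real n ^ k * fact (n - k)"
proof -
  have "(fact n :: nat) = fact n div fact (n - k) * fact (n - k)"
    by (rule dvd_div_mult_self[symmetric]) (simp add: fact_dvd)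
  also have "\<dots> \<le> n ^ k * fact (n - k)"
    by (rule mult_le_mono1[OF fact_div_fact_le_pow[OF assms]])
  finally have "real (fact n) \<le> real (n ^ k * fact (n - k))" by (rule of_nat_mono)
  then show ?thesis by simp
qed

text \<open>Both \<open>p\<close> and \<open>q\<close> are close in mean square to the constant \<open>v\<close>, so their covariance is small.
  The first hypothesis says that \<open>a\<close> is the correlation of \<open>v\<close> with itself.\<close>
lemma cross_correlation_close:
  fixes p q :: "'a \<Rightarrow> real" and v a d :: real
  assumes v: "v * v * card A = a"
    and p: "(\<Sum>X\<in>A. (p X)\<^sup>2) \<le> a + d" "\<bar>v * (\<Sum>X\<in>A. p X) - a\<bar> \<le> d"
    and q: "(\<Sum>X\<in>A. (q X)\<^sup>2) \<le> a + d" "\<bar>v * (\<Sum>X\<in>A. q X) - a\<bar> \<le> d"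
  shows "\<bar>(\<Sum>X\<in>A. p X * q X) - a\<bar> \<le> 5 * d"
proof -
  have var: "(\<Sum>X\<in>A. (h X - v)\<^sup>2) = (\<Sum>X\<in>A. (h X)\<^sup>2) - 2 * (v * (\<Sum>X\<in>A. h X)) + a"
    for h :: "'a \<Rightarrow> real"
  proof -
    have "(\<Sum>X\<in>A. (h X - v)\<^sup>2) = (\<Sum>X\<in>A. (h X)\<^sup>2 - 2 * v * h X + v * v)"
      by (simp add: power2_eq_square algebra_simps)
    then show ?thesis
      unfolding v[symmetric]
      by (simp add: sum.distrib sum_subtractf sum_distrib_left mult_ac)
  qed
  have cov: "(\<Sum>X\<in>A. p X * q X)
      = (\<Sum>X\<in>A. (p X - v) * (q X - v)) + v * (\<Sum>X\<in>A. p X) + v * (\<Sum>X\<in>A. q X) - a"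
  proof -
    have "(\<Sum>X\<in>A. (p X - v) * (q X - v)) = (\<Sum>X\<in>A. p X * q X - v * p X - v * q X + v * v)"
      by (simp add: algebra_simps)
    then show ?thesis
      unfolding v[symmetric]
      by (simp add: sum.distrib sum_subtractf sum_distrib_left mult_ac)
  qed
  \<comment> \<open>each variance is at most \<open>(a + d) - 2 (a - d) + a = 3 d\<close>\<close>
  have "\<bar>\<Sum>X\<in>A. (p X - v) * (q X - v)\<bar> \<le> (\<Sum>X\<in>A. ((p X - v)\<^sup>2 + (q X - v)\<^sup>2) / 2)"
  proof (rule order_trans[OF sum_abs], rule sum_mono)
    fix X
    have "0 \<le> (\<bar>p X - v\<bar> - \<bar>q X - v\<bar>)\<^sup>2" by simp
    then show "\<bar>(p X - v) * (q X - v)\<bar> \<le> ((p X - v)\<^sup>2 + (q X - v)\<^sup>2) / 2"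
      by (simp add: power2_diff abs_mult)
  qed
  also have "\<dots> = ((\<Sum>X\<in>A. (p X - v)\<^sup>2) + (\<Sum>X\<in>A. (q X - v)\<^sup>2)) / 2"
    by (simp add: sum.distrib sum_divide_distrib[symmetric])
  finally have c: "\<bar>\<Sum>X\<in>A. (p X - v) * (q X - v)\<bar> \<le> 3 * d"
    using p q unfolding var abs_le_iff by argo
  show ?thesis using c p(2) q(2) unfolding cov abs_le_iff by argo
qed

section \<open>Pairs with a prescribed number of agreements\<close>

text \<open>With \<open>N = m + a\<close> the left hand side is \<open>N choose m\<close> times
  \<open>1 - a + (a choose 2) - (a choose 3) = - (a - 1) (a - 2) (a - 3) / 6\<close>, which is at most 0 for
  every natural number \<open>a\<close> except \<open>a = 0\<close>. A lower bound needs an odd number of correction terms,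
  and a single one has expectation 0 under a Poisson distribution of mean 1; with three terms the
  expectation is positive.\<close>
lemma bonferroni_exact_le:
  fixes N m :: nat
  shows "real (N choose m) - ((m + 1) choose m) * (N choose (m + 1))
      + ((m + 2) choose m) * (N choose (m + 2)) - ((m + 3) choose m) * (N choose (m + 3))
    \<le> (if N = m then 1 else 0)"
proof (cases "m \<le> N")
  case True
  define a where "a = N - m"
  have eq: "((m + j) choose m) * (N choose (m + j)) = (N choose m) * (a choose j)" for j
  proof (cases "m + j \<le> N")
    case True
    then show ?thesis using choose_mult[of m "m + j" N] by (simp add: a_def mult.commute)
  next
    case False
    then have "N < m + j" "a < j" using \<open>m \<le> N\<close> by (auto simp: a_def)
    then show ?thesis by (simp add: binomial_eq_0)
  qed
  have eqr: "real ((m + j) choose m) * real (N choose (m + j))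
      = real (N choose m) * real (a choose j)" for j
    using arg_cong[OF eq[of j], of real] by simp
  have "real (a choose 0) - real (a choose 1) + real (a choose 2) - real (a choose 3)
      \<le> (if N = m then 1 else 0)"
  proof (cases a)
    case 0
    then show ?thesis using True by (simp add: a_def binomial_eq_0)
  next
    case (Suc b)
    then have "N \<noteq> m" by (auto simp: a_def)
    then show ?thesis by (simp add: Suc numeral_eq_Suc)
  qed
  then have "real (N choose m)
      * (real (a choose 0) - real (a choose 1) + real (a choose 2) - real (a choose 3))
      \<le> real (N choose m) * (if N = m then 1 else 0)"
    by (rule mult_left_mono) simp
  also have "\<dots> = (if N = m then 1 else 0)" by simp
  finally show ?thesis
    using eqr[of 0] eqr[of 1] eqr[of 2] eqr[of 3] by (simp add: algebra_simps)
qed (simp add: binomial_eq_0)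

text \<open>Correlations of order \<open>k\<close> are binomial moments of the number of common cells outside the
  base matchings.\<close>
lemma sum_link_mult_link:
  assumes G: "G \<subseteq> Sym n" and G': "G' \<subseteq> Sym n"
  shows "(\<Sum>X\<in>matchings n k. link n S G X * link n S' G' X)
    = (\<Sum>\<sigma>\<in>G. \<Sum>\<tau>\<in>G'. real (card ((pts n \<sigma> - S) \<inter> (pts n \<tau> - S')) choose k)) / (card G * card G')"
proof -
  have fin: "finite G" using G finite_subset finite_Sym by blast
  have inner: "(\<Sum>X | X \<subseteq> pts n \<tau> - S' \<and> card X = k. link n S G X)
      = (\<Sum>\<sigma>\<in>G. real (card ((pts n \<sigma> - S) \<inter> (pts n \<tau> - S')) choose k)) / card G" for \<tau>
  proof -
    let ?A = "{X. X \<subseteq> pts n \<tau> - S' \<and> card X = k}"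
    have finA: "finite ?A"
    proof (rule finite_subset)
      show "?A \<subseteq> Pow (pts n \<tau>)" by blast
    qed simp
    have "(\<Sum>X\<in>?A. real (card {\<sigma> \<in> G. X \<subseteq> pts n \<sigma> - S}))
        = (\<Sum>X\<in>?A. \<Sum>\<sigma>\<in>G. if X \<subseteq> pts n \<sigma> - S then 1 else 0)"
      using fin by (simp add: sum.inter_filter[symmetric])
    also have "\<dots> = (\<Sum>\<sigma>\<in>G. \<Sum>X\<in>?A. if X \<subseteq> pts n \<sigma> - S then 1 else 0)"
      by (rule sum.swap)
    also have "\<dots> = (\<Sum>\<sigma>\<in>G. real (card ((pts n \<sigma> - S) \<inter> (pts n \<tau> - S')) choose k))"
    proof (rule sum.cong[OF refl])
      fix \<sigma>
      have "{X \<in> ?A. X \<subseteq> pts n \<sigma> - S}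
          = {X. X \<subseteq> (pts n \<sigma> - S) \<inter> (pts n \<tau> - S') \<and> card X = k}" by blast
      then show "(\<Sum>X\<in>?A. if X \<subseteq> pts n \<sigma> - S then 1 else (0::real))
          = real (card ((pts n \<sigma> - S) \<inter> (pts n \<tau> - S')) choose k)"
        using finA n_subsets[of "(pts n \<sigma> - S) \<inter> (pts n \<tau> - S')" k]
        by (simp add: sum.inter_filter[symmetric])
    qed
    finally show ?thesis unfolding link_def by (simp add: sum_divide_distrib[symmetric])
  qed
  have "(\<Sum>X\<in>matchings n k. link n S G X * link n S' G' X)
      = (\<Sum>\<tau>\<in>G'. (\<Sum>\<sigma>\<in>G. real (card ((pts n \<sigma> - S) \<inter> (pts n \<tau> - S')) choose k)) / card G) / card G'"
    unfolding inner[symmetric] by (rule sum_mult_link[OF G'])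
  also have "\<dots> = (\<Sum>\<tau>\<in>G'. \<Sum>\<sigma>\<in>G. real (card ((pts n \<sigma> - S) \<inter> (pts n \<tau> - S')) choose k))
      / (card G * card G')"
    by (simp add: sum_divide_distrib[symmetric])
  also have "(\<Sum>\<tau>\<in>G'. \<Sum>\<sigma>\<in>G. real (card ((pts n \<sigma> - S) \<inter> (pts n \<tau> - S')) choose k))
      = (\<Sum>\<sigma>\<in>G. \<Sum>\<tau>\<in>G'. real (card ((pts n \<sigma> - S) \<inter> (pts n \<tau> - S')) choose k))"
    by (rule sum.swap)
  finally show ?thesis .
qed

text \<open>The single parameter \<open>K\<close> bounds both the size of \<open>S\<close> and the exponent of the density of \<open>G\<close> in
  its star. The last condition allows \<open>X\<close> to be over-represented by a factor of \<open>n powr (1/8)\<close>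
  compared with a random permutation; any exponent below \<open>1/4\<close> would leave room for the choice of
  \<open>l\<close> in \<open>quasirandom_sum_link_sq\<close>.\<close>
definition quasirandom ::
  "nat \<Rightarrow> nat \<Rightarrow> nat \<Rightarrow> (nat \<times> nat) set \<Rightarrow> (nat \<Rightarrow> nat) set \<Rightarrow> bool" where
  "quasirandom n d K S G \<longleftrightarrow> G \<subseteq> star n S \<and> G \<noteq> {} \<and> card S \<le> K
    \<and> fact (n - card S) \<le> real n ^ K * card G
    \<and> (\<forall>X. 1 \<le> card X \<and> card X \<le> d \<longrightarrow> link n S G X \<le> real n powr (1/8) / real n ^ card X)"

lemma link_le_1: "link n S G X \<le> 1"
proof (cases "finite G")
  case True
  then have "card {\<sigma> \<in> G. X \<subseteq> pts n \<sigma> - S} \<le> card G" by (intro card_mono) auto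
  then show ?thesis by (auto simp: link_def divide_le_eq_1)
qed (simp add: link_def)

text \<open>Here \<open>sum_link_sq_le\<close> has Lipschitz constant of order \<open>n powr (1/8) / n\<close>. With
  \<open>l = n powr (1/2)\<close> the two error terms are of order \<open>ln n / n powr (1/2)\<close> and
  \<open>n powr (- 1/4)\<close>.\<close>
lemma quasirandom_sum_link_sq:
  fixes \<delta> :: real
  assumes "k \<le> d" "\<delta> > 0"
  shows "\<forall>\<^sub>F n in sequentially. \<forall>S G. quasirandom n d K S G \<longrightarrow>
    (\<Sum>X\<in>matchings n k. (link n S G X)\<^sup>2) \<le> 1 / fact k + \<delta>"
proof (cases "k = 0")
  case True
  have "(\<Sum>X\<in>matchings n 0. (link n S G X)\<^sup>2) \<le> 1 + \<delta>" if "quasirandom n d K S G" for n S G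
  proof -
    have "(\<Sum>X\<in>matchings n 0. (link n S G X)\<^sup>2) \<le> (\<Sum>X\<in>matchings n 0. link n S G X)"
      using link_le_1 by (intro sum_mono) (simp add: power2_eq_square mult_left_le)
    also have "\<dots> = 1" using that sum_link[of G n S 0] by (simp add: quasirandom_def)
    finally show ?thesis using assms by simp
  qed
  then show ?thesis using True by simp
next
  case False
  have "((\<lambda>n. K * ln (real n) / real n powr (1/2)
      + n * real n powr (1/2) * (2 * real n powr (1/8) / n)\<^sup>2) \<longlongrightarrow> 0) sequentially"
    by real_asymp
  from order_tendstoD(2)[OF this \<open>\<delta> > 0\<close>]
  have "\<forall>\<^sub>F n in sequentially. K * ln (real n) / real n powr (1/2)
      + n * real n powr (1/2) * (2 * real n powr (1/8) / n)\<^sup>2 < \<delta>" .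
  moreover have "\<forall>\<^sub>F n in sequentially. real n powr (1/2) * (2 * real n powr (1/8) / n) \<le> 1"
    by real_asymp
  ultimately show ?thesis using eventually_gt_at_top[of 0]
  proof eventually_elim
    case (elim n)
    show ?case
    proof (intro allI impI)
      fix S G assume "quasirandom n d K S G"
      then have G: "G \<subseteq> star n S" "G \<noteq> {}" and dens: "fact (n - card S) \<le> real n ^ K * card G"
        and low: "\<And>X. 1 \<le> card X \<Longrightarrow> card X \<le> d \<Longrightarrow> link n S G X \<le> real n powr (1/8) / real n ^ card X"
        by (auto simp: quasirandom_def)
      have "real n ^ k = real n * real n ^ (k - 1)"
        using False by (cases k) auto
      then have c: "2 * real n ^ (k - 1) * (real n powr (1/8) / real n ^ k) = 2 * real n powr (1/8) / n"
        using elim(3) by simp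
      have "(\<Sum>X\<in>matchings n k. (link n S G X)\<^sup>2)
          \<le> 1 / fact k + ln (real n ^ K) / real n powr (1/2)
            + n * real n powr (1/2) * (2 * real n ^ (k - 1) * (real n powr (1/8) / real n ^ k))\<^sup>2"
      proof (rule sum_link_sq_le[OF G])
        have "star n S \<noteq> {}" using G by blast
        then show "real (card (star n S)) \<le> real n ^ K * real (card G)"
          using card_star[of n S] dens by simp
        show "link n S G X \<le> real n powr (1/8) / real n ^ k" if "X \<in> matchings n k" for X
          using low[of X] that False assms by (simp add: matchings_def)
      qed (use elim False c in auto)
      then show "(\<Sum>X\<in>matchings n k. (link n S G X)\<^sup>2) \<le> 1 / fact k + \<delta>"
        using elim(1,3) unfolding c by (simp add: ln_realpow)
    qed
  qed
qed

text \<open>The sum is exactly a binomial coefficient by \<open>sum_link\<close>; fixing at most \<open>K\<close> cells of the board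
  does not change its leading term.\<close>
lemma quasirandom_sum_link:
  fixes \<delta> :: real
  assumes "\<delta> > 0"
  shows "\<forall>\<^sub>F n in sequentially. \<forall>S G. quasirandom n d K S G \<longrightarrow>
    \<bar>fact (n - k) / fact n * (\<Sum>X\<in>matchings n k. link n S G X) - 1 / fact k\<bar> \<le> \<delta>"
proof -
  have "((\<lambda>n. (real n - real (K + k)) / real n) \<longlongrightarrow> 1) sequentially"
    by real_asymp
  then have "((\<lambda>n. 1 / fact k * ((real n - real (K + k)) / real n) ^ k) \<longlongrightarrow> 1 / fact k * 1 ^ k) sequentially"
    by (intro tendsto_intros)
  from order_tendstoD(1)[OF this, of "1 / fact k - \<delta>"] assms
  have "\<forall>\<^sub>F n in sequentially. 1 / fact k - \<delta> < 1 / fact k * ((real n - real (K + k)) / real n) ^ k"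
    by simp
  then show ?thesis using eventually_gt_at_top[of "K + k"]
  proof eventually_elim
    case (elim n)
    show ?case
    proof (intro allI impI)
      fix S G assume "quasirandom n d K S G"
      then have G: "G \<subseteq> star n S" "G \<noteq> {}" and s: "card S \<le> K"
        by (auto simp: quasirandom_def)
      define v :: real where "v = fact (n - k) / fact n"
      have v: "v \<ge> 0" by (simp add: v_def)
      have "v * ((n - card S) choose k) \<le> v * (n choose k)"
        using v by (intro mult_left_mono) (auto intro: binomial_right_mono)
      also have "\<dots> = 1 / fact k"
        using elim by (simp add: binomial_fact v_def)
      finally have up: "v * ((n - card S) choose k) \<le> 1 / fact k" .
      have "(real n - real (K + k)) ^ k * fact (n - card S - k)
          \<le> real (n - card S - k) ^ k * fact (n - card S - k)"
        using elim s by (intro mult_right_mono power_mono) auto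
      also have "\<dots> \<le> fact (n - card S)"
        using elim s by (intro power_diff_mult_fact_le) auto
      finally have "1 / fact k * (real n - real (K + k)) ^ k \<le> (n - card S) choose k"
        using elim s by (simp add: binomial_fact field_simps)
      moreover have "1 / real n ^ k \<le> v"
        using fact_le_power_mult_fact[of k n] elim by (simp add: v_def field_simps)
      ultimately have "(1 / real n ^ k) * (1 / fact k * (real n - real (K + k)) ^ k)
          \<le> v * ((n - card S) choose k)"
        using elim v by (intro mult_mono) auto
      then have "1 / fact k - \<delta> \<le> v * ((n - card S) choose k)"
        using elim by (simp add: power_divide mult.commute)
      then show "\<bar>fact (n - k) / fact n * (\<Sum>X\<in>matchings n k. link n S G X) - 1 / fact k\<bar> \<le> \<delta>"
        using up assms unfolding sum_link[OF G] v_def by linarith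
    qed
  qed
qed

lemma quasirandom_correlation:
  fixes \<delta> :: real
  assumes "k \<le> d" "\<delta> > 0"
  shows "\<forall>\<^sub>F n in sequentially. \<forall>S G S' G'. quasirandom n d K S G \<and> quasirandom n d K S' G' \<longrightarrow>
    \<bar>(\<Sum>X\<in>matchings n k. link n S G X * link n S' G' X) - 1 / fact k\<bar> \<le> \<delta>"
proof -
  have d: "\<delta> / 5 > 0" using assms by simp
  show ?thesis
    using quasirandom_sum_link_sq[OF assms(1) d, of K] quasirandom_sum_link[OF d, of d K k]
      eventually_ge_at_top[of k]
  proof eventually_elim
    case (elim n)
    show ?case
    proof (intro allI impI, elim conjE)
      fix S G S' G' assume q: "quasirandom n d K S G" "quasirandom n d K S' G'"
      have "fact (n - k) / fact n * (fact (n - k) / fact n) * real (card (matchings n k)) = 1 / fact k"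
        unfolding card_matchings[OF elim(3)] using elim(3) by (simp add: binomial_fact)
      from cross_correlation_close[OF this] elim(1,2) q
      have "\<bar>(\<Sum>X\<in>matchings n k. link n S G X * link n S' G' X) - 1 / fact k\<bar> \<le> 5 * (\<delta> / 5)"
        by blast
      then show "\<bar>(\<Sum>X\<in>matchings n k. link n S G X * link n S' G' X) - 1 / fact k\<bar> \<le> \<delta>" by simp
    qed
  qed
qed

text \<open>A pair of members \<open>\<sigma>\<close> of \<open>G\<close> and \<open>\<tau>\<close> of \<open>G'\<close> has \<open>card (S \<inter> S') + N\<close> agreements, where \<open>N\<close>
  counts the common cells outside \<open>S\<close> and \<open>S'\<close> respectively, unless \<open>\<sigma>\<close> hits \<open>S' - S\<close> or \<open>\<tau>\<close> hits
  \<open>S - S'\<close>. The latter events have total probability at most \<open>(card S + card S') * \<beta>\<close>, while the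
  event \<open>N = m\<close> has probability at least \<open>1 / (3 * fact m)\<close> up to the error in \<open>\<delta>\<close>.\<close>
lemma exact_agreement_pair:
  fixes \<delta> \<beta> :: real
  assumes G: "G \<subseteq> star n S" "G \<noteq> {}" and G': "G' \<subseteq> star n S'" "G' \<noteq> {}"
    and corr: "\<And>k. k \<le> m + 3 \<Longrightarrow>
      \<bar>(\<Sum>X\<in>matchings n k. link n S G X * link n S' G' X) - 1 / fact k\<bar> \<le> \<delta>"
    and hit: "\<And>x. link n S G {x} \<le> \<beta>" "\<And>x. link n S' G' {x} \<le> \<beta>"
    and small: "(1 + ((m + 1) choose m) + ((m + 2) choose m) + ((m + 3) choose m)) * \<delta>
      + (card S + card S') * \<beta> < 1 / (3 * fact m)"
  shows "\<exists>\<sigma>\<in>G. \<exists>\<tau>\<in>G'. card (pts n \<sigma> \<inter> pts n \<tau>) = card (S \<inter> S') + m"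
proof (rule ccontr)
  assume none: "\<not> ?thesis"
  define N where "N \<sigma> \<tau> = card ((pts n \<sigma> - S) \<inter> (pts n \<tau> - S'))" for \<sigma> \<tau>
  define T where "T k = (\<Sum>X\<in>matchings n k. link n S G X * link n S' G' X)" for k
  define b where "b \<sigma> = (\<Sum>x\<in>S'. if {x} \<subseteq> pts n \<sigma> - S then 1 else (0::real))" for \<sigma>
  define b' where "b' \<tau> = (\<Sum>x\<in>S. if {x} \<subseteq> pts n \<tau> - S' then 1 else (0::real))" for \<tau>
  define P where "P = real (card G * card G')"
  define h where "h N = real (N choose m) - ((m + 1) choose m) * (N choose (m + 1))
      + ((m + 2) choose m) * (N choose (m + 2)) - ((m + 3) choose m) * (N choose (m + 3))" for N
  have fin: "finite G" "finite G'" using G G' finite_subset finite_star by blast+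
  then have cG: "real (card G) > 0" "real (card G') > 0" using G G' by (simp_all add: card_gt_0_iff)
  then have P: "P > 0" by (simp add: P_def)
  have finS: "finite S" "finite S'" using G G' star_card_le by blast+
  have corr_count: "(\<Sum>\<sigma>\<in>G. \<Sum>\<tau>\<in>G'. real (N \<sigma> \<tau> choose k)) = T k * P" for k
  proof -
    have "T k = (\<Sum>\<sigma>\<in>G. \<Sum>\<tau>\<in>G'. real (N \<sigma> \<tau> choose k)) / P"
      unfolding T_def N_def P_def
      using G(1) G'(1) star_subset_Sym by (intro sum_link_mult_link) blast+
    then show ?thesis using P by simp
  qed
  \<comment> \<open>\<open>b \<sigma>\<close> and \<open>b' \<tau>\<close> count the forbidden hits, so they pay for every pair with \<open>N \<sigma> \<tau> = m\<close>\<close>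
  have pointwise: "h (N \<sigma> \<tau>) \<le> b \<sigma> + b' \<tau>" if st: "\<sigma> \<in> G" "\<tau> \<in> G'" for \<sigma> \<tau>
  proof -
    have b0: "b \<sigma> \<ge> 0" "b' \<tau> \<ge> 0" by (simp_all add: b_def b'_def sum_nonneg)
    show ?thesis
    proof (cases "N \<sigma> \<tau> = m")
      case False
      then show ?thesis using bonferroni_exact_le[of "N \<sigma> \<tau>" m] b0 by (simp add: h_def)
    next
      case True
      have S: "S \<subseteq> pts n \<sigma>" "S' \<subseteq> pts n \<tau>" using st G G' by (auto simp: star_def simp del: mem_pts)
      have "\<not> (pts n \<sigma> \<inter> (S' - S) = {} \<and> pts n \<tau> \<inter> (S - S') = {})"
      proof
        assume "pts n \<sigma> \<inter> (S' - S) = {} \<and> pts n \<tau> \<inter> (S - S') = {}"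
        then have "pts n \<sigma> \<inter> pts n \<tau> = (S \<inter> S') \<union> ((pts n \<sigma> - S) \<inter> (pts n \<tau> - S'))"
          using S by blast
        then have "card (pts n \<sigma> \<inter> pts n \<tau>) = card (S \<inter> S') + N \<sigma> \<tau>"
          unfolding N_def using finS by (simp, subst card_Un_disjoint) auto
        then show False using none st True by auto
      qed
      then have "b \<sigma> \<ge> 1 \<or> b' \<tau> \<ge> 1"
      proof (elim de_Morgan_conj[THEN iffD1, elim_format] disjE)
        assume "pts n \<sigma> \<inter> (S' - S) \<noteq> {}"
        then obtain x where x: "x \<in> pts n \<sigma>" "x \<in> S'" "x \<notin> S" by blast
        have "(if {x} \<subseteq> pts n \<sigma> - S then 1 else (0::real)) \<le> b \<sigma>"
          unfolding b_def using x(2) finS by (intro member_le_sum) auto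
        then show ?thesis using x by simp
      next
        assume "pts n \<tau> \<inter> (S - S') \<noteq> {}"
        then obtain x where x: "x \<in> pts n \<tau>" "x \<in> S" "x \<notin> S'" by blast
        have "(if {x} \<subseteq> pts n \<tau> - S' then 1 else (0::real)) \<le> b' \<tau>"
          unfolding b'_def using x(2) finS by (intro member_le_sum) auto
        then show ?thesis using x by simp
      qed
      then show ?thesis using bonferroni_exact_le[of "N \<sigma> \<tau>" m] b0 True by (auto simp: h_def)
    qed
  qed
  have sum_b: "(\<Sum>\<sigma>\<in>H. \<Sum>x\<in>A. if {x} \<subseteq> pts n \<sigma> - B then 1 else (0::real)) \<le> card A * \<beta> * card H"
    if "finite H" "real (card H) > 0" and le: "\<And>x. link n B H {x} \<le> \<beta>" for H A B
  proof -
    have "H \<noteq> {}" using that(2) by auto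
    have "(\<Sum>\<sigma>\<in>H. \<Sum>x\<in>A. if {x} \<subseteq> pts n \<sigma> - B then 1 else (0::real))
        = (\<Sum>x\<in>A. \<Sum>\<sigma>\<in>H. if {x} \<subseteq> pts n \<sigma> - B then 1 else 0)" by (rule sum.swap)
    also have "\<dots> = (\<Sum>x\<in>A. link n B H {x} * card H)"
      using that(1) \<open>H \<noteq> {}\<close> by (simp add: sum.inter_filter[symmetric] link_def del: insert_subset)
    also have "\<dots> \<le> (\<Sum>x\<in>A. \<beta> * card H)"
      by (intro sum_mono mult_right_mono le) auto
    finally show ?thesis by (simp add: mult_ac)
  qed
  have "(T m - ((m + 1) choose m) * T (m + 1) + ((m + 2) choose m) * T (m + 2)
      - ((m + 3) choose m) * T (m + 3)) * P = (\<Sum>\<sigma>\<in>G. \<Sum>\<tau>\<in>G'. h (N \<sigma> \<tau>))"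
    unfolding h_def
    by (simp add: sum.distrib sum_subtractf sum_distrib_left[symmetric] corr_count algebra_simps
        del: One_nat_def)
  also have "\<dots> \<le> (\<Sum>\<sigma>\<in>G. \<Sum>\<tau>\<in>G'. b \<sigma> + b' \<tau>)"
    by (intro sum_mono pointwise)
  also have "\<dots> = card G' * (\<Sum>\<sigma>\<in>G. b \<sigma>) + card G * (\<Sum>\<tau>\<in>G'. b' \<tau>)"
    by (simp add: sum.distrib sum_distrib_left)
  also have "\<dots> \<le> card G' * (card S' * \<beta> * card G) + card G * (card S * \<beta> * card G')"
    unfolding b_def b'_def using fin cG hit
    by (intro add_mono mult_left_mono sum_b) auto
  also have "\<dots> = ((card S + card S') * \<beta>) * P" by (simp add: P_def algebra_simps)
  finally have main: "T m - ((m + 1) choose m) * T (m + 1) + ((m + 2) choose m) * T (m + 2)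
      - ((m + 3) choose m) * T (m + 3) \<le> (card S + card S') * \<beta>"
    using P by (rule mult_right_le_imp_le)
  have Tk: "((m + j) choose m) * T (m + j) \<le> 1 / (fact m * fact j) + ((m + j) choose m) * \<delta>"
    "((m + j) choose m) * T (m + j) \<ge> 1 / (fact m * fact j) - ((m + j) choose m) * \<delta>"
    if "j \<le> 3" for j
  proof -
    have e: "real ((m + j) choose m) * (1 / fact (m + j)) = 1 / (fact m * fact j)"
      by (simp add: binomial_fact)
    have c: "\<bar>T (m + j) - 1 / fact (m + j)\<bar> \<le> \<delta>" unfolding T_def using that by (intro corr) simp
    have "((m + j) choose m) * T (m + j) \<le> ((m + j) choose m) * (1 / fact (m + j) + \<delta>)"
      using c by (intro mult_left_mono) auto
    then show "((m + j) choose m) * T (m + j) \<le> 1 / (fact m * fact j) + ((m + j) choose m) * \<delta>"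
      unfolding distrib_left e .
    have "((m + j) choose m) * (1 / fact (m + j) - \<delta>) \<le> ((m + j) choose m) * T (m + j)"
      using c by (intro mult_left_mono) auto
    then show "((m + j) choose m) * T (m + j) \<ge> 1 / (fact m * fact j) - ((m + j) choose m) * \<delta>"
      unfolding right_diff_distrib e .
  qed
  have "1 / (3 * fact m) = 1 / (fact m * fact 0) - 1 / (fact m * fact 1)
      + 1 / (fact m * fact 2) - 1 / (fact m * fact 3 :: real)"
    by (simp add: fact_numeral field_simps)
  then show False
    using main small Tk(2)[of 0] Tk(1)[of 1] Tk(2)[of 2] Tk(1)[of 3]
    by (simp add: distrib_right del: One_nat_def binomial_Suc_n)
qed

lemma quasirandom_agreement_offset:
  assumes "m + 3 \<le> d"
  shows "\<forall>\<^sub>F n in sequentially. \<forall>S G S' G'. quasirandom n d K S G \<and> quasirandom n d K S' G' \<longrightarrow>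
    (\<exists>\<sigma>\<in>G. \<exists>\<tau>\<in>G'. card (pts n \<sigma> \<inter> pts n \<tau>) = card (S \<inter> S') + m)"
proof -
  define c :: real where "c = 1 + ((m + 1) choose m) + ((m + 2) choose m) + ((m + 3) choose m)"
  define \<delta> where "\<delta> = 1 / (6 * fact m) / c"
  have c: "c > 0" by (simp add: c_def add_pos_nonneg)
  then have \<delta>: "\<delta> > 0" by (simp add: \<delta>_def)
  have "\<forall>\<^sub>F n in sequentially. \<forall>k\<in>{..m + 3}. \<forall>S G S' G'. quasirandom n d K S G \<and> quasirandom n d K S' G' \<longrightarrow>
    \<bar>(\<Sum>X\<in>matchings n k. link n S G X * link n S' G' X) - 1 / fact k\<bar> \<le> \<delta>"
    using assms \<delta> by (intro eventually_ball_finite ballI quasirandom_correlation) auto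
  moreover have "((\<lambda>n. real (2 * K) * (real n powr (1/8) / real n)) \<longlongrightarrow> 0) sequentially"
    by real_asymp
  from order_tendstoD(2)[OF this, of "1 / (6 * fact m)"]
  have "\<forall>\<^sub>F n in sequentially. real (2 * K) * (real n powr (1/8) / real n) < 1 / (6 * fact m)"
    by simp
  ultimately show ?thesis
  proof eventually_elim
    case (elim n)
    show ?case
    proof (intro allI impI, elim conjE)
      fix S G S' G' assume q: "quasirandom n d K S G" "quasirandom n d K S' G'"
      define \<beta> where "\<beta> = real n powr (1/8) / real n"
      have hit: "link n T H {x} \<le> \<beta>" if "quasirandom n d K T H" for T H x
      proof -
        have "1 \<le> card {x} \<and> card {x} \<le> d" using assms by simp
        then have "link n T H {x} \<le> real n powr (1/8) / real n ^ card {x}"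
          using that unfolding quasirandom_def by blast
        then show ?thesis by (simp add: \<beta>_def)
      qed
      have "(card S + card S') * \<beta> \<le> real (2 * K) * \<beta>"
        using q by (intro mult_right_mono) (auto simp: quasirandom_def \<beta>_def)
      have "c * \<delta> = 1 / (6 * fact m)" using c by (simp add: \<delta>_def)
      have small: "c * \<delta> + (card S + card S') * \<beta> < 1 / (3 * fact m)"
      proof -
        have "1 / (6 * fact m) + 1 / (6 * fact m) = 1 / (3 * fact m :: real)" by (simp add: field_simps)
        then show ?thesis
          using elim(2) \<open>c * \<delta> = _\<close> \<open>_ \<le> real (2 * K) * \<beta>\<close> unfolding \<beta>_def[symmetric] by linarith
      qed
      show "\<exists>\<sigma>\<in>G. \<exists>\<tau>\<in>G'. card (pts n \<sigma> \<inter> pts n \<tau>) = card (S \<inter> S') + m"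
      proof (rule exact_agreement_pair)
        show "\<bar>(\<Sum>X\<in>matchings n k. link n S G X * link n S' G' X) - 1 / fact k\<bar> \<le> \<delta>"
          if "k \<le> m + 3" for k
          using elim(1) q that by blast
      qed (use q hit small in \<open>auto simp: quasirandom_def c_def\<close>)
    qed
  qed
qed

text \<open>Apply \<open>quasirandom_agreement_offset\<close> with \<open>m = t - 1 - card (S \<inter> S')\<close>. As
  \<open>m + 3 \<le> t + 2\<close>, quasirandomness up to order \<open>t + 2\<close> is enough.\<close>
lemma quasirandom_exact_agreement:
  assumes "t \<ge> 1"
  shows "\<forall>\<^sub>F n in sequentially. \<forall>S G S' G'. quasirandom n (t + 2) K S G \<and> quasirandom n (t + 2) K S' G'
    \<and> card (S \<inter> S') < t \<longrightarrow> (\<exists>\<sigma>\<in>G. \<exists>\<tau>\<in>G'. card (pts n \<sigma> \<inter> pts n \<tau>) = t - 1)"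
proof -
  have "\<forall>\<^sub>F n in sequentially. \<forall>m\<in>{..<t}. \<forall>S G S' G'.
    quasirandom n (t + 2) K S G \<and> quasirandom n (t + 2) K S' G' \<longrightarrow>
    (\<exists>\<sigma>\<in>G. \<exists>\<tau>\<in>G'. card (pts n \<sigma> \<inter> pts n \<tau>) = card (S \<inter> S') + m)"
    by (intro eventually_ball_finite ballI quasirandom_agreement_offset) auto
  then show ?thesis
  proof eventually_elim
    case (elim n)
    show ?case
    proof (intro allI impI, elim conjE)
      fix S G S' G'
      assume q: "quasirandom n (t + 2) K S G" "quasirandom n (t + 2) K S' G'" and lt: "card (S \<inter> S') < t"
      have "t - 1 - card (S \<inter> S') \<in> {..<t}" using assms by auto
      then have "\<exists>\<sigma>\<in>G. \<exists>\<tau>\<in>G'. card (pts n \<sigma> \<inter> pts n \<tau>) = card (S \<inter> S') + (t - 1 - card (S \<inter> S'))"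
        using elim q by blast
      then show "\<exists>\<sigma>\<in>G. \<exists>\<tau>\<in>G'. card (pts n \<sigma> \<inter> pts n \<tau>) = t - 1" using lt by simp
    qed
  qed
qed

section \<open>Decomposition into quasirandom pieces\<close>

lemma max_weight_exists:
  fixes g :: "'a \<Rightarrow> real"
  assumes "finite A" "A \<noteq> {}"
  obtains x where "x \<in> A" "\<And>y. y \<in> A \<Longrightarrow> g y \<le> g x"
proof -
  have "Max (g ` A) \<in> g ` A" using assms by (intro Max_in) auto
  then obtain x where "x \<in> A" "Max (g ` A) = g x" by auto
  then show ?thesis using that[of x] assms Max_ge[of "g ` A"] by auto
qed

text \<open>Choose \<open>S\<close> among the partial matchings with at most \<open>q + d\<close> cells so that \<open>R ^ card S\<close> times
  the number of members of \<open>F\<close> containing \<open>S\<close> is largest, where \<open>R = n powr (1 - 1 / (8 * d))\<close>.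
  Comparison with the empty matching gives the lower bound on the density. If \<open>S\<close> had more than
  \<open>q\<close> cells, its star would be too small to contain that many members. Hence adding up to \<open>d\<close> cells
  stays within the range of the maximum, and comparison with \<open>S \<union> X\<close> gives the bound on links; the loss
  against \<open>n ^ card X\<close> is \<open>n powr (card X / (8 * d)) \<le> n powr (1/8)\<close>.\<close>
lemma quasirandom_piece_exists:
  assumes d: "d \<ge> 1" and q: "q = 16 * d * r"
  shows "\<forall>\<^sub>F n in sequentially. \<forall>F\<subseteq>Sym n. real (card F) > fact n / real n ^ r \<longrightarrow>
    (\<exists>S. card S \<le> q \<and> quasirandom n d (r + q) S {\<sigma> \<in> F. S \<subseteq> pts n \<sigma>})"
proof -
  define e :: real where "e = 1 / (16 * d)"
  have e: "e > 0" using d by (simp add: e_def)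
  then have "filterlim (\<lambda>n. real n powr e) at_top sequentially" by real_asymp
  then have "\<forall>\<^sub>F n in sequentially. 2 \<le> real n powr e" by (simp add: filterlim_at_top)
  then show ?thesis using eventually_ge_at_top[of "2 * (q + d) + 1"]
  proof eventually_elim
    case (elim n)
    show ?case
    proof (intro allI impI)
      fix F assume F: "F \<subseteq> Sym n" and big: "real (card F) > fact n / real n ^ r"
      have n: "real n \<ge> 1" using elim(2) by simp
      define R where "R = real n powr (1 - 2 * e)"
      have R: "R > 0" using n by (simp add: R_def)
      \<comment> \<open>\<open>R\<close> falls short of \<open>n\<close> by the factor \<open>n powr (2 * e)\<close>: one half of it absorbs the powers of 2 below, the other half beats \<open>n ^ r\<close>\<close>
      have Rpow: "R ^ k * real n powr (2 * e * k) = real n ^ k" for k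
      proof -
        have "R ^ k = real n powr ((1 - 2 * e) * k)" using n by (simp add: R_def powr_powr flip: powr_realpow)
        then have "R ^ k * real n powr (2 * e * k) = real n powr k"
          by (simp add: powr_add[symmetric] algebra_simps)
        then show ?thesis using n by (simp add: powr_realpow)
      qed
      define fam where "fam S = {\<sigma> \<in> F. S \<subseteq> pts n \<sigma>}" for S
      have finF: "finite F" using F finite_subset finite_Sym by blast
      define g where "g S = card (fam S) * R ^ card S" for S
      define \<C> where "\<C> = {S. card S \<le> q + d \<and> (\<exists>\<sigma>\<in>Sym n. S \<subseteq> pts n \<sigma>)}"
      have "finite \<C>"
      proof (rule finite_subset)
        show "\<C> \<subseteq> (\<Union>\<sigma>\<in>Sym n. Pow (pts n \<sigma>))" by (auto simp: \<C>_def simp del: mem_pts)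
      qed simp
      moreover have "id \<in> Sym n" by (simp add: Sym_def permutes_id)
      then have empty: "{} \<in> \<C>" unfolding \<C>_def by auto
      ultimately obtain S where S: "S \<in> \<C>" and max: "\<And>S'. S' \<in> \<C> \<Longrightarrow> g S' \<le> g S"
        using max_weight_exists[of \<C> g] by blast
      define s where "s = card S"
      define G where "G = fam S"
      have gS: "real (card F) \<le> card G * R ^ s"
        using max[OF empty] by (simp add: g_def fam_def G_def s_def)
      have "0 \<le> fact n / real n ^ r" by simp
      then have "card G * R ^ s > 0" using gS big by linarith
      then have cG: "real (card G) > 0" using R by (simp add: zero_less_mult_iff)
      then have Gne: "G \<noteq> {}" by auto
      have Gstar: "G \<subseteq> star n S" using F by (auto simp: G_def fam_def star_def)
      have ne: "star n S \<noteq> {}" using Gne Gstar by blast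
      have sqd: "s \<le> q + d" using S by (simp add: \<C>_def s_def)
      have Gle: "real (card G) \<le> fact (n - s)"
      proof -
        have "card G \<le> fact (n - s)" using card_mono[OF finite_star Gstar] card_star[OF ne] by (simp add: s_def)
        then have "real (card G) \<le> real (fact (n - s))" by (rule of_nat_mono)
        then show ?thesis by simp
      qed
      have "fact n / real n ^ r < card G * R ^ s" using gS big by linarith
      then have low: "fact n < real n ^ r * (card G * R ^ s)"
        using n by (simp add: field_simps)
      have sq: "s \<le> q"
      proof (rule ccontr)
        assume "\<not> s \<le> q"
        then have "s > q" by simp
        have "(real n / 2) ^ s \<le> real (n - s) ^ s"
          using elim(2) sqd by (intro power_mono) auto
        then have "(real n / 2) ^ s * fact (n - s) \<le> real (n - s) ^ s * fact (n - s)"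
          by (intro mult_right_mono) auto
        also have "\<dots> \<le> fact n" using elim(2) sqd by (intro power_diff_mult_fact_le) auto
        also have "\<dots> < real n ^ r * (card G * R ^ s)" by (rule low)
        also have "\<dots> \<le> real n ^ r * (fact (n - s) * R ^ s)"
          using Gle R by (intro mult_left_mono mult_right_mono) auto
        finally have "(real n / 2) ^ s < real n ^ r * R ^ s" by (simp add: mult_ac)
        then have "real n ^ s < real n ^ r * R ^ s * 2 ^ s" by (simp add: power_divide field_simps)
        also have "real n ^ s = R ^ s * (real n powr (e * s) * real n powr (e * s))"
          unfolding Rpow[of s, symmetric] by (simp add: powr_add[symmetric] mult.assoc)
        finally have "real n powr (e * s) * real n powr (e * s) < real n ^ r * 2 ^ s"
          using R by (simp add: mult_ac)
        also have "\<dots> \<le> real n ^ r * real n powr (e * s)"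
        proof (intro mult_left_mono)
          have "(2::real) ^ s \<le> (real n powr e) ^ s" using elim(1) by (intro power_mono) auto
          also have "\<dots> = real n powr (e * s)" using n by (simp add: powr_powr flip: powr_realpow)
          finally show "(2::real) ^ s \<le> real n powr (e * s)" .
        qed simp
        finally have "real n powr (e * s) < real n powr r" using n by (simp add: powr_realpow)
        then have "e * s < r" using n by (meson not_le powr_mono)
        moreover have "e * q = r" using d by (simp add: e_def q)
        moreover have "e * q \<le> e * s" using e \<open>s > q\<close> by (intro mult_left_mono) auto
        ultimately show False by simp
      qed
      have "quasirandom n d (r + q) S G" unfolding quasirandom_def
      proof (intro conjI allI impI Gstar Gne)
        show "card S \<le> r + q" using sq by (simp add: s_def)
        have "R \<le> real n powr 1" unfolding R_def using e n by (intro powr_mono) auto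
        then have "R ^ s \<le> real n ^ s" using R n by (intro power_mono) auto
        also have "\<dots> \<le> real n ^ q" using n sq by (intro power_increasing) auto
        finally have Rs: "R ^ s \<le> real n ^ q" .
        have "fact (n - s) \<le> (fact n :: real)" by (intro fact_mono) simp
        also have "\<dots> \<le> real n ^ r * (card G * R ^ s)" using low by simp
        also have "\<dots> \<le> real n ^ r * (card G * real n ^ q)"
          using Rs by (intro mult_left_mono) auto
        finally show "fact (n - card S) \<le> real n ^ (r + q) * real (card G)"
          by (simp add: s_def power_add mult_ac)
        fix X :: "(nat \<times> nat) set" assume X: "1 \<le> card X \<and> card X \<le> d"
        show "link n S G X \<le> real n powr (1/8) / real n ^ card X"
        proof (cases "{\<sigma> \<in> G. X \<subseteq> pts n \<sigma> - S} = {}")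
          case True
          then have "link n S G X = 0" by (simp only: link_def) simp
          then show ?thesis by simp
        next
          case False
          then obtain \<sigma> where \<sigma>: "\<sigma> \<in> G" "X \<subseteq> pts n \<sigma> - S" by blast
          then have sub: "S \<subseteq> pts n \<sigma>" "X \<subseteq> pts n \<sigma>" "\<sigma> \<in> Sym n"
            using F by (auto simp: G_def fam_def simp del: mem_pts)
          have "finite S" "finite X" using finite_subset[OF sub(1)] finite_subset[OF sub(2)] by auto
          then have cu: "card (S \<union> X) = s + card X"
            using \<sigma> unfolding s_def by (intro card_Un_disjoint) auto
          have "S \<union> X \<in> \<C>" using cu sub sq X unfolding \<C>_def by (auto simp del: mem_pts)
          then have "g (S \<union> X) \<le> g S" by (rule max)
          moreover have "fam (S \<union> X) = {\<sigma> \<in> G. X \<subseteq> pts n \<sigma> - S}"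
            using \<sigma> by (auto simp: fam_def G_def simp del: mem_pts)
          ultimately have "card {\<sigma> \<in> G. X \<subseteq> pts n \<sigma> - S} * R ^ (s + card X) \<le> card G * R ^ s"
            unfolding g_def cu by (simp add: G_def s_def)
          then have "card {\<sigma> \<in> G. X \<subseteq> pts n \<sigma> - S} * R ^ card X \<le> card G"
            using R by (simp add: power_add mult_ac)
          then have "link n S G X \<le> 1 / R ^ card X"
            using cG R by (simp add: link_def field_simps)
          also have "\<dots> = real n powr (2 * e * card X) / real n ^ card X"
            unfolding Rpow[symmetric] using R n by simp
          also have "\<dots> \<le> real n powr (1/8) / real n ^ card X"
          proof (intro divide_right_mono powr_mono)
            have "2 * e * card X \<le> 2 * e * d" using X e by (intro mult_left_mono) auto
            also have "\<dots> = 1/8" using d by (simp add: e_def)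
            finally show "2 * e * card X \<le> 1/8" .
          qed (use n in auto)
          finally show ?thesis .
        qed
      qed
      then show "\<exists>S. card S \<le> q \<and> quasirandom n d (r + q) S {\<sigma> \<in> F. S \<subseteq> pts n \<sigma>}"
        using sq unfolding G_def fam_def s_def by blast
    qed
  qed
qed

text \<open>Remove quasirandom pieces greedily until at most \<open>fact n / n ^ r\<close> permutations are left.\<close>
lemma quasirandom_decomposition:
  assumes d: "d \<ge> 1"
  shows "\<forall>\<^sub>F n in sequentially. \<forall>F\<subseteq>Sym n. \<exists>\<S>. finite \<S>
    \<and> (\<forall>S\<in>\<S>. card S \<le> 16 * d * r \<and> (\<exists>G\<subseteq>F. quasirandom n d (r + 16 * d * r) S G))
    \<and> real (card (F - (\<Union>S\<in>\<S>. star n S))) \<le> fact n / real n ^ r"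
  using quasirandom_piece_exists[OF d refl, of r]
proof eventually_elim
  case (elim n)
  let ?q = "16 * d * r"
  have "\<exists>\<S>. finite \<S> \<and> (\<forall>S\<in>\<S>. card S \<le> ?q \<and> (\<exists>G\<subseteq>F. quasirandom n d (r + ?q) S G))
    \<and> real (card (F - (\<Union>S\<in>\<S>. star n S))) \<le> fact n / real n ^ r" if "F \<subseteq> Sym n" for F
    using that
  proof (induction "card F" arbitrary: F rule: less_induct)
    case less
    show ?case
    proof (cases "real (card F) \<le> fact n / real n ^ r")
      case True
      then show ?thesis by (intro exI[of _ "{}"]) simp
    next
      case False
      then obtain S where S: "card S \<le> ?q" "quasirandom n d (r + ?q) S {\<sigma> \<in> F. S \<subseteq> pts n \<sigma>}"
        using elim less.prems by (meson not_le)
      let ?F = "{\<sigma> \<in> F. \<not> S \<subseteq> pts n \<sigma>}"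
      have finF: "finite F" using less.prems finite_subset finite_Sym by blast
      have "{\<sigma> \<in> F. S \<subseteq> pts n \<sigma>} \<noteq> {}" using S by (simp only: quasirandom_def simp_thms)
      then have "?F \<subset> F" by blast
      then have "card ?F < card F" by (rule psubset_card_mono[OF finF])
      moreover have "?F \<subseteq> Sym n" using less.prems by blast
      ultimately obtain \<S> where \<S>: "finite \<S>"
        "\<forall>S\<in>\<S>. card S \<le> ?q \<and> (\<exists>G\<subseteq>?F. quasirandom n d (r + ?q) S G)"
        "real (card (?F - (\<Union>S\<in>\<S>. star n S))) \<le> fact n / real n ^ r"
        using less.hyps[of ?F] by blast
      have eq: "F - (\<Union>T\<in>insert S \<S>. star n T) = ?F - (\<Union>S\<in>\<S>. star n S)"
        using less.prems by (auto simp: star_def)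
      show ?thesis
      proof (intro exI[of _ "insert S \<S>"] conjI ballI)
        show "real (card (F - (\<Union>T\<in>insert S \<S>. star n T))) \<le> fact n / real n ^ r"
          unfolding eq by (rule \<S>(3))
        fix T assume "T \<in> insert S \<S>"
        then show "\<exists>G\<subseteq>F. quasirandom n d (r + ?q) T G"
        proof
          assume "T = S"
          then show ?thesis using S(2) by (intro exI[of _ "{\<sigma> \<in> F. S \<subseteq> pts n \<sigma>}"]) simp
        next
          assume "T \<in> \<S>"
          then obtain G where "G \<subseteq> ?F" "quasirandom n d (r + ?q) T G" using \<S>(2) by blast
          then show ?thesis by (intro exI[of _ G]) blast
        qed
      qed (use S \<S> in auto)
    qed
  qed
  then show ?case by blast
qed

section \<open>Few generators suffice\<close>

text \<open>Let \<open>\<M>\<close> be a maximal \<open>t\<close>-intersecting family of sets of size at most \<open>q\<close> that contains \<open>\<A>\<close>. If a set \<open>T\<close>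
  of size at most \<open>q\<close> is not in \<open>\<M>\<close> but lies below a member of \<open>\<M>\<close>, maximality yields \<open>M\<close> in \<open>\<M>\<close> with fewer than \<open>t\<close> elements in
  \<open>T \<inter> M\<close>, so each member of \<open>\<M>\<close> above \<open>T\<close> contains one of the at most \<open>q\<close> elements
  of \<open>M - T\<close>. Branching over these elements, starting from the empty set, reaches every minimal
  member within \<open>q\<close> steps: one choice at each step adds an element of that member, and by minimality
  no proper subset of it on the way belongs to \<open>\<M>\<close>.\<close>
lemma t_intersecting_bounded_cover:
  fixes \<A> :: "'a set set"
  assumes V: "finite V" and \<A>: "\<And>A. A \<in> \<A> \<Longrightarrow> A \<subseteq> V \<and> card A \<le> q"
    and inter: "\<And>A B. A \<in> \<A> \<Longrightarrow> B \<in> \<A> \<Longrightarrow> t \<le> card (A \<inter> B)"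
  obtains \<B> where "finite \<B>" "card \<B> \<le> q ^ q"
    "\<And>B. B \<in> \<B> \<Longrightarrow> card B \<le> q \<and> (\<exists>A\<in>\<A>. B \<subseteq> A)"
    "\<And>A. A \<in> \<A> \<Longrightarrow> \<exists>B\<in>\<B>. B \<subseteq> A"
    "\<And>A B. A \<in> \<B> \<Longrightarrow> B \<in> \<B> \<Longrightarrow> t \<le> card (A \<inter> B)"
proof -
  define W where "W = {A. A \<subseteq> V \<and> card A \<le> q}"
  define \<F> where "\<F> = {\<M>. \<M> \<subseteq> W \<and> (\<forall>A\<in>\<M>. \<forall>B\<in>\<M>. t \<le> card (A \<inter> B))}"
  have finW: "finite W" using V by (simp add: W_def)
  have "finite \<F>"
  proof (rule finite_subset)
    show "\<F> \<subseteq> Pow W" by (auto simp: \<F>_def)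
  qed (simp add: finW)
  moreover have "\<A> \<in> \<F>" using \<A> inter by (auto simp: \<F>_def W_def)
  ultimately have "\<exists>\<M>\<in>\<F>. \<A> \<subseteq> \<M> \<and> (\<forall>\<N>\<in>\<F>. \<M> \<subseteq> \<N> \<longrightarrow> \<M> = \<N>)"
    by (rule finite_has_maximal2)
  then obtain \<M> where \<M>: "\<M> \<in> \<F>" "\<A> \<subseteq> \<M>" and max: "\<forall>\<N>\<in>\<F>. \<M> \<subseteq> \<N> \<longrightarrow> \<M> = \<N>"
    by (elim bexE conjE)
  have MW: "\<M> \<subseteq> W" and Mt: "\<And>A B. A \<in> \<M> \<Longrightarrow> B \<in> \<M> \<Longrightarrow> t \<le> card (A \<inter> B)"
    using \<M>(1) by (auto simp: \<F>_def)
  have finM: "finite \<M>" using MW finW finite_subset by blast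
  have fin_mem: "finite A" "card A \<le> q" "A \<subseteq> V" if "A \<in> \<M>" for A
  proof -
    have "A \<in> W" using that MW by blast
    then show "card A \<le> q" "A \<subseteq> V" by (simp_all add: W_def)
    then show "finite A" using V finite_subset by blast
  qed
  define Min where "Min = {U \<in> \<M>. \<forall>A\<in>\<M>. A \<subseteq> U \<longrightarrow> A = U}"
  have separated: "\<exists>M\<in>\<M>. card (T \<inter> M) < t" if T: "T \<subseteq> V" "card T \<le> q" "T \<notin> \<M>" "\<M> \<noteq> {}" for T
  proof (rule ccontr)
    assume none: "\<not> ?thesis"
    have fT: "finite T" using T V finite_subset by blast
    obtain M where "M \<in> \<M>" using T by blast
    then have "t \<le> card (T \<inter> M)" using none by (simp add: not_less)
    also have "\<dots> \<le> card T" using fT by (intro card_mono) auto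
    finally have "t \<le> card T" .
    then have "insert T \<M> \<in> \<F>"
      using T MW Mt none by (auto simp: \<F>_def W_def not_less Int_commute)
    then have "\<M> = insert T \<M>" using bspec[OF max] by blast
    then show False using T by blast
  qed
  have count: "card {U \<in> Min. T \<subseteq> U \<and> card (U - T) \<le> j} \<le> q ^ j" if "j \<le> q" "T \<subseteq> V" for T j
    using that
  proof (induction j arbitrary: T)
    case 0
    have "{U \<in> Min. T \<subseteq> U \<and> card (U - T) \<le> 0} \<subseteq> {T}"
    proof
      fix U assume U: "U \<in> {U \<in> Min. T \<subseteq> U \<and> card (U - T) \<le> 0}"
      then have "finite (U - T)" using fin_mem by (auto simp: Min_def)
      then show "U \<in> {T}" using U by auto
    qed
    then have "card {U \<in> Min. T \<subseteq> U \<and> card (U - T) \<le> 0} \<le> card {T}" by (intro card_mono) auto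
    then show ?case by simp
  next
    case (Suc j)
    let ?S = "{U \<in> Min. T \<subseteq> U \<and> card (U - T) \<le> Suc j}"
    consider "?S = {}" | "T \<in> \<M>" | U0 where "U0 \<in> ?S" "T \<notin> \<M>" by blast
    then show ?case
    proof cases
      case 1
      show ?thesis unfolding 1 by simp
    next
      case 2
      then have "?S \<subseteq> {T}" by (auto simp: Min_def)
      then have "card ?S \<le> card {T}" by (intro card_mono) auto
      also have "card {T} \<le> q ^ Suc j" using Suc.prems(1) one_le_power[of q "Suc j"] by simp
      finally show ?thesis .
    next
      case 3
      then have U0: "U0 \<in> \<M>" "T \<subseteq> U0" by (auto simp: Min_def)
      have "card T \<le> q" using card_mono[OF fin_mem(1)[OF U0(1)] U0(2)] fin_mem(2)[OF U0(1)] by simp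
      then obtain M where M: "M \<in> \<M>" "card (T \<inter> M) < t"
        using separated[OF Suc.prems(2)] 3 U0 by blast
      have "?S \<subseteq> (\<Union>x\<in>M. {U \<in> Min. insert x T \<subseteq> U \<and> card (U - insert x T) \<le> j})"
      proof
        fix U assume U: "U \<in> ?S"
        then have UM: "U \<in> \<M>" by (simp add: Min_def)
        have "\<not> U \<inter> M \<subseteq> T \<inter> M"
        proof
          assume "U \<inter> M \<subseteq> T \<inter> M"
          then have "card (U \<inter> M) \<le> card (T \<inter> M)"
            using fin_mem(1)[OF M(1)] by (intro card_mono) auto
          then show False using Mt[OF UM M(1)] M(2) by simp
        qed
        then obtain x where x: "x \<in> U" "x \<in> M" "x \<notin> T" by blast
        have "U - insert x T = (U - T) - {x}" by blast
        then have "card (U - insert x T) = card (U - T) - 1"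
          using x by (simp add: card_Diff_singleton)
        then show "U \<in> (\<Union>x\<in>M. {U \<in> Min. insert x T \<subseteq> U \<and> card (U - insert x T) \<le> j})"
          using U x by auto
      qed
      then have "card ?S \<le> card (\<Union>x\<in>M. {U \<in> Min. insert x T \<subseteq> U \<and> card (U - insert x T) \<le> j})"
        using finM fin_mem(1)[OF M(1)] by (intro card_mono) (auto simp: Min_def)
      also have "\<dots> \<le> (\<Sum>x\<in>M. card {U \<in> Min. insert x T \<subseteq> U \<and> card (U - insert x T) \<le> j})"
        by (rule card_UN_le) (rule fin_mem(1)[OF M(1)])
      also have "\<dots> \<le> (\<Sum>x\<in>M. q ^ j)"
        using fin_mem(3)[OF M(1)] Suc.prems by (intro sum_mono Suc.IH) auto
      also have "\<dots> \<le> q ^ Suc j" using fin_mem(2)[OF M(1)] by simp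
      finally show ?thesis .
    qed
  qed
  show ?thesis
  proof (rule that[of "{B \<in> Min. \<exists>A\<in>\<A>. B \<subseteq> A}"])
    have finMin: "finite Min" using finM by (simp add: Min_def)
    then show "finite {B \<in> Min. \<exists>A\<in>\<A>. B \<subseteq> A}" by simp
    have "card {B \<in> Min. \<exists>A\<in>\<A>. B \<subseteq> A} \<le> card {U \<in> Min. {} \<subseteq> U \<and> card (U - {}) \<le> q}"
    proof (rule card_mono)
      show "finite {U \<in> Min. {} \<subseteq> U \<and> card (U - {}) \<le> q}" using finMin by simp
    qed (use fin_mem(2) in \<open>auto simp: Min_def\<close>)
    also have "\<dots> \<le> q ^ q" by (rule count) auto
    finally show "card {B \<in> Min. \<exists>A\<in>\<A>. B \<subseteq> A} \<le> q ^ q" .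
    show "\<exists>B\<in>{B \<in> Min. \<exists>A\<in>\<A>. B \<subseteq> A}. B \<subseteq> A" if A: "A \<in> \<A>" for A
    proof -
      have "A \<in> {B \<in> \<M>. B \<subseteq> A}" "finite {B \<in> \<M>. B \<subseteq> A}" using A \<M>(2) finM by auto
      then obtain B where B: "B \<in> {B \<in> \<M>. B \<subseteq> A}" "\<forall>C\<in>{B \<in> \<M>. B \<subseteq> A}. C \<subseteq> B \<longrightarrow> B = C"
        using finite_has_minimal2[of "{B \<in> \<M>. B \<subseteq> A}" A] by blast
      then have "B \<in> Min" unfolding Min_def by blast
      then show ?thesis using B A by blast
    qed
  qed (use fin_mem Mt in \<open>auto simp: Min_def\<close>)
qed

lemma mem_star_iff_agree:
  assumes "\<rho> \<in> star n B"
  shows "\<sigma> \<in> star n B \<longleftrightarrow> \<sigma> \<in> Sym n \<and> (\<forall>j\<in>fst ` B. \<sigma> j = \<rho> j)"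
proof -
  have \<rho>: "j \<in> {1..n} \<and> b = \<rho> j" if "(j, b) \<in> B" for j b
  proof -
    have "(j, b) \<in> pts n \<rho>" using assms that by (auto simp: star_def simp del: mem_pts)
    then show ?thesis by simp
  qed
  have "B \<subseteq> pts n \<sigma> \<longleftrightarrow> (\<forall>j\<in>fst ` B. \<sigma> j = \<rho> j)"
  proof
    assume B: "B \<subseteq> pts n \<sigma>"
    show "\<forall>j\<in>fst ` B. \<sigma> j = \<rho> j"
    proof
      fix j assume "j \<in> fst ` B"
      then obtain b where b: "(j, b) \<in> B" by force
      then have "(j, b) \<in> pts n \<sigma>" using B by blast
      then show "\<sigma> j = \<rho> j" using \<rho>[OF b] by simp
    qed
  next
    assume agree: "\<forall>j\<in>fst ` B. \<sigma> j = \<rho> j"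
    show "B \<subseteq> pts n \<sigma>"
    proof (rule subrelI)
      fix j b assume jb: "(j, b) \<in> B"
      then have "\<sigma> j = \<rho> j" using agree by force
      then show "(j, b) \<in> pts n \<sigma>" using \<rho>[OF jb] by simp
    qed
  qed
  then show ?thesis by (simp add: star_def)
qed

lemma junta_Union_star:
  assumes \<B>: "finite \<B>" "card \<B> \<le> C" "\<And>B. B \<in> \<B> \<Longrightarrow> card B \<le> C \<and> star n B \<noteq> {}"
  shows "junta n C (\<Union>B\<in>\<B>. star n B)"
proof -
  obtain e where e: "bij_betw e {1..card \<B>} \<B>"
    using ex_bij_betw_nat_finite_1[OF \<B>(1)] by blast
  then have e_in: "e i \<in> \<B>" if "i \<in> {1..card \<B>}" for i using that by (auto simp: bij_betw_def)
  define \<pi> where "\<pi> i = (SOME \<sigma>. \<sigma> \<in> star n (e i))" for i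
  have \<pi>: "\<pi> i \<in> star n (e i)" if "i \<in> {1..card \<B>}" for i
    unfolding \<pi>_def using \<B>(3)[OF e_in[OF that]] by (simp add: some_in_eq)
  have star_iff: "\<sigma> \<in> star n (e i) \<longleftrightarrow> \<sigma> \<in> Sym n \<and> (\<forall>j\<in>fst ` e i. \<sigma> j = \<pi> i j)"
    if i: "i \<in> {1..card \<B>}" for i \<sigma>
    by (rule mem_star_iff_agree[OF \<pi>[OF i]])
  show ?thesis unfolding junta_def
  proof (intro exI conjI ballI)
    show "card \<B> \<le> C" by fact
    fix i assume i: "i \<in> {1..card \<B>}"
    have p: "\<pi> i permutes {1..n}" and sub: "e i \<subseteq> pts n (\<pi> i)"
      using \<pi>[OF i] by (auto simp: star_def Sym_def)
    show S: "fst ` e i \<subseteq> {1..n}" using sub by (auto simp: pts_def)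
    have "\<pi> i ` fst ` e i \<subseteq> \<pi> i ` {1..n}" by (rule image_mono[OF S])
    then show "\<pi> i ` fst ` e i \<subseteq> {1..n}" unfolding permutes_image[OF p] .
    show "bij_betw (\<pi> i) (fst ` e i) (\<pi> i ` fst ` e i)"
      by (rule inj_on_imp_bij_betw[OF inj_on_subset[OF permutes_inj[OF p] subset_UNIV]])
    have "card (fst ` e i) \<le> card (e i)"
      using finite_subset[OF sub] by (intro card_image_le) simp
    also have "\<dots> \<le> C" using \<B>(3)[OF e_in[OF i]] by (rule conjunct1)
    finally show "card (fst ` e i) \<le> C" .
  next
    have "(\<Union>B\<in>\<B>. star n B) = (\<Union>i\<in>{1..card \<B>}. star n (e i))"
      using bij_betw_imp_surj_on[OF e] by (metis image_image)
    also have "\<dots> = generated n (card \<B>) (\<lambda>i. fst ` e i) \<pi>"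
    proof (rule set_eqI)
      fix \<sigma>
      show "\<sigma> \<in> (\<Union>i\<in>{1..card \<B>}. star n (e i)) \<longleftrightarrow> \<sigma> \<in> generated n (card \<B>) (\<lambda>i. fst ` e i) \<pi>"
        unfolding generated_def UN_iff mem_Collect_eq using star_iff by (metis (no_types, lifting))
    qed
    finally show "(\<Union>B\<in>\<B>. star n B) = generated n (card \<B>) (\<lambda>i. fst ` e i) \<pi>" .
  qed
qed

lemma t_intersecting_Union_star:
  assumes "\<And>A B. A \<in> \<B> \<Longrightarrow> B \<in> \<B> \<Longrightarrow> t \<le> card (A \<inter> B)"
  shows "t_intersecting n t (\<Union>B\<in>\<B>. star n B)"
  unfolding t_intersecting_def
proof (intro ballI)
  fix \<sigma> \<tau> assume "\<sigma> \<in> (\<Union>B\<in>\<B>. star n B)" "\<tau> \<in> (\<Union>B\<in>\<B>. star n B)"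
  then obtain A B where AB: "A \<in> \<B>" "B \<in> \<B>" "A \<subseteq> pts n \<sigma>" "B \<subseteq> pts n \<tau>"
    by (auto simp: star_def)
  have "t \<le> card (A \<inter> B)" using assms AB by blast
  also have "\<dots> \<le> card (pts n \<sigma> \<inter> pts n \<tau>)" using AB by (intro card_mono) auto
  finally show "t \<le> card (agreement n \<sigma> \<tau>)" unfolding card_agreement .
qed

section \<open>The junta approximation\<close>

theorem theorem1p2:
  fixes r t :: nat
  shows "\<exists>C::nat. \<forall>n\<ge>1. \<forall>F\<subseteq>Sym n. intersection_free n (int t - 1) F \<longrightarrow>
    (\<exists>J\<subseteq>Sym n. junta n C J \<and> t_intersecting n t J \<and>
       real (card (F - J)) \<le> real C * fact n / real n ^ r)"
proof (cases "t = 0")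
  case True
  have "junta n 1 (Sym n)" for n
    using junta_Union_star[of "{{}}" 1 n] card_Sym[of n] by fastforce
  then show ?thesis using True
    by (intro exI[of _ 1] allI impI, intro exI[of _ "Sym _"]) (auto simp: t_intersecting_def Diff_eq_empty_iff[THEN iffD2])
next
  case False
  define d where "d = t + 2"
  define q where "q = 16 * d * r"
  obtain n0 where n0: "\<And>n. n \<ge> n0 \<Longrightarrow> n > t \<and>
    (\<forall>F\<subseteq>Sym n. \<exists>\<S>. finite \<S> \<and> (\<forall>S\<in>\<S>. card S \<le> q \<and> (\<exists>G\<subseteq>F. quasirandom n d (r + q) S G))
      \<and> real (card (F - (\<Union>S\<in>\<S>. star n S))) \<le> fact n / real n ^ r) \<and>
    (\<forall>S G S' G'. quasirandom n d (r + q) S G \<and> quasirandom n d (r + q) S' G'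
      \<and> card (S \<inter> S') < t \<longrightarrow> (\<exists>\<sigma>\<in>G. \<exists>\<tau>\<in>G'. card (pts n \<sigma> \<inter> pts n \<tau>) = t - 1))"
  proof -
    have "1 \<le> t" "1 \<le> d" using False by (auto simp: d_def)
    from eventually_conj[OF eventually_gt_at_top[of t] eventually_conj[OF
        quasirandom_decomposition[OF this(2), of r] quasirandom_exact_agreement[OF this(1), of "r + q"]]]
    show ?thesis using that unfolding eventually_sequentially d_def[symmetric] q_def[symmetric] by blast
  qed
  define C where "C = q ^ q + q + n0 ^ r + 1"
  show ?thesis
  proof (intro exI[of _ C] allI impI)
    fix n F assume n: "1 \<le> n" and F: "F \<subseteq> Sym n" and free: "intersection_free n (int t - 1) F"
    show "\<exists>J\<subseteq>Sym n. junta n C J \<and> t_intersecting n t J \<and>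
       real (card (F - J)) \<le> real C * fact n / real n ^ r"
    proof (cases "n \<ge> n0")
      case False
      have "junta n C {}" using junta_Union_star[of "{}" C n] by simp
      moreover have "real (card F) \<le> real C * fact n / real n ^ r"
      proof -
        have "card F \<le> fact n" using card_mono[OF finite_Sym F] by (simp add: card_Sym)
        then have "real (card F) \<le> real (fact n)" by (rule of_nat_mono)
        then have "real (card F) * real n ^ r \<le> fact n * real C"
        proof (intro mult_mono)
          have "real n ^ r \<le> real n0 ^ r" using False by (intro power_mono) auto
          also have "\<dots> \<le> real C" by (simp add: C_def)
          finally show "real n ^ r \<le> real C" .
        qed auto
        then show ?thesis using n by (simp add: field_simps)
      qed
      ultimately show ?thesis by (intro exI[of _ "{}"]) (auto simp: t_intersecting_def)
    next
      case True
      have "n > t" by (rule n0[OF True, THEN conjunct1])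
      note decomposition = n0[OF True, THEN conjunct2, THEN conjunct1, rule_format, OF F]
      note exact_pair = n0[OF True, THEN conjunct2, THEN conjunct2, rule_format]
      obtain \<S> where "finite \<S>"
        and pieces: "\<forall>S\<in>\<S>. card S \<le> q \<and> (\<exists>G\<subseteq>F. quasirandom n d (r + q) S G)"
        and rest: "real (card (F - (\<Union>S\<in>\<S>. star n S))) \<le> fact n / real n ^ r"
        using decomposition by (elim exE conjE)
      have inter: "t \<le> card (S \<inter> S')" if S: "S \<in> \<S>" "S' \<in> \<S>" for S S'
      proof (rule ccontr)
        assume "\<not> t \<le> card (S \<inter> S')"
        moreover obtain G G' where G: "G \<subseteq> F" "quasirandom n d (r + q) S G"
          "G' \<subseteq> F" "quasirandom n d (r + q) S' G'"
          using bspec[OF pieces S(1)] bspec[OF pieces S(2)] by blast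
        ultimately have "quasirandom n d (r + q) S G \<and> quasirandom n d (r + q) S' G'
            \<and> card (S \<inter> S') < t" by simp
        then obtain \<sigma> \<tau> where st: "\<sigma> \<in> G" "\<tau> \<in> G'" "card (pts n \<sigma> \<inter> pts n \<tau>) = t - 1"
          using exact_pair by blast
        have "\<sigma> \<noteq> \<tau>"
        proof
          assume "\<sigma> = \<tau>"
          then show False using st(3) \<open>n > t\<close> by simp
        qed
        moreover have "\<sigma> \<in> F" "\<tau> \<in> F" using st G by blast+
        ultimately have "int (card (agreement n \<sigma> \<tau>)) \<noteq> int t - 1"
          using free unfolding intersection_free_def by simp
        then show False using st(3) \<open>t \<noteq> 0\<close> unfolding card_agreement by simp
      qed
      have star_ne: "star n S \<noteq> {}" if "S \<in> \<S>" for S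
        using bspec[OF pieces that] by (auto simp: quasirandom_def)
      have sub: "S \<subseteq> {1..n} \<times> {1..n}" if S: "S \<in> \<S>" for S
      proof -
        obtain \<sigma> where \<sigma>: "\<sigma> permutes {1..n}" "S \<subseteq> pts n \<sigma>"
          using star_ne[OF S] by (auto simp: star_def Sym_def)
        have "pts n \<sigma> \<subseteq> {1..n} \<times> {1..n}"
          unfolding pts_def using permutes_in_image[OF \<sigma>(1)] by blast
        then show ?thesis using \<sigma>(2) by blast
      qed
      obtain \<B> where \<B>: "finite \<B>" "card \<B> \<le> q ^ q"
        "\<And>B. B \<in> \<B> \<Longrightarrow> card B \<le> q \<and> (\<exists>A\<in>\<S>. B \<subseteq> A)"
        "\<And>A. A \<in> \<S> \<Longrightarrow> \<exists>B\<in>\<B>. B \<subseteq> A"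
        "\<And>A B. A \<in> \<B> \<Longrightarrow> B \<in> \<B> \<Longrightarrow> t \<le> card (A \<inter> B)"
        by (rule t_intersecting_bounded_cover[of "{1..n} \<times> {1..n}" \<S> q t])
          (use sub pieces inter in auto)
      define J where "J = (\<Union>B\<in>\<B>. star n B)"
      have "junta n C J" unfolding J_def
      proof (rule junta_Union_star[OF \<B>(1)])
        show "card \<B> \<le> C" using \<B>(2) by (simp add: C_def)
        fix B assume "B \<in> \<B>"
        then obtain A where A: "card B \<le> q" "A \<in> \<S>" "B \<subseteq> A" using \<B>(3) by blast
        then have "star n A \<subseteq> star n B" by (auto simp: star_def simp del: mem_pts)
        then show "card B \<le> C \<and> star n B \<noteq> {}" using A star_ne[OF A(2)] by (auto simp: C_def)
      qed
      moreover have "t_intersecting n t J" unfolding J_def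
        by (rule t_intersecting_Union_star) (rule \<B>(5))
      moreover have "real (card (F - J)) \<le> real C * fact n / real n ^ r"
      proof -
        have "(\<Union>S\<in>\<S>. star n S) \<subseteq> J"
        proof
          fix \<sigma> assume "\<sigma> \<in> (\<Union>S\<in>\<S>. star n S)"
          then obtain S where S: "S \<in> \<S>" "\<sigma> \<in> star n S" by blast
          obtain B where "B \<in> \<B>" "B \<subseteq> S" using \<B>(4)[OF S(1)] by blast
          then have "\<sigma> \<in> star n B" using S(2) by (auto simp: star_def simp del: mem_pts)
          then show "\<sigma> \<in> J" using \<open>B \<in> \<B>\<close> by (auto simp: J_def)
        qed
        then have "F - J \<subseteq> F - (\<Union>S\<in>\<S>. star n S)" by blast
        moreover have "finite F" using F finite_subset finite_Sym by blast
        ultimately have "card (F - J) \<le> card (F - (\<Union>S\<in>\<S>. star n S))" by (intro card_mono) auto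
        then have "real (card (F - J)) \<le> 1 * (fact n / real n ^ r)" using rest by simp
        also have "\<dots> \<le> real C * (fact n / real n ^ r)"
          by (intro mult_right_mono) (auto simp: C_def)
        finally show ?thesis by simp
      qed
      moreover have "J \<subseteq> Sym n" using star_subset_Sym by (auto simp: J_def)
      ultimately show ?thesis by blast
    qed
  qed
qed

end
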